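(* The monochromatic complete symmetric functions $S_n^{(i)}$ ($n\ge1$, $0\le i\le l-1$) generate a Hopf subalgebra $\mathrm{MR}^{(l)}$ of $\mathbf{Sym}^{(l)}$, which is isomorphic to the Mantaci–Reutenauer descent algebra of the wreath products $\mathfrak S_n^{(l)}=(\mathbb Z/l\mathbb Z)\wr\mathfrak S_n$: for every $n$, under the identification $\mathbf G_h\mapsto h$ ($h\in\mathfrak S_n^{(l)}$), the degree $n$ component of $\mathrm{MR}^{(l)}$ is identified with the Mantaci–Reutenauer descent algebra in $\mathbb C[\mathfrak S_n^{(l)}]$.
   Context: Here $\mathbb N=\{0,1,2,\dots\}$, $l\ge1$, and the set of colors is $C=\mathbb Z/l\mathbb Z=\{0,\dots,l-1\}$. A colored permutation of size $n\ge0$ is a pair $(\sigma,u)$ with $\sigma\in\mathfrak S_n$, $u\in C^n$ (permutations are written as words). $\mathrm{Std}$ of a word with distinct integer letters is the permutation whose letters are in the same relative order. $\mathbf{FQSym}^{(l)}$ is the graded Hopf algebra over $\mathbb C$ with basis $(\mathbf G_{\sigma,u})$ indexed by colored permutations (degree = size), product $\mathbf G_{\sigma',u'}\mathbf G_{\sigma'',u''}=\sum_{\sigma}\mathbf G_{\sigma,u'\cdot u''}$, the sum over permutations $\sigma$ of size $|\sigma'|+|\sigma''|$ whose first $|\sigma'|$ letters standardize to $\sigma'$ and whose remaining letters standardize to $\sigma''$, and coproduct $\Delta\mathbf G_{\sigma,u}=\sum_{i=0}^n\mathbf G_{(\sigma,u)_{[1,i]}}\otimes\mathbf G_{(\sigma,u)_{[i+1,n]}}$,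 where $(\sigma,u)_{[a,b]}=(\mathrm{Std}(\sigma'),u')$ with $\sigma'$ the subword of $\sigma$ of letters in $[a,b]$ and $u'$ the subword of $u$ at the same positions. For $\mathbf n=(n_0,\dots,n_{l-1})\in\mathbb N^l$ with $\sum_i n_i=n$, $S_{\mathbf n}=\sum_u\mathbf G_{12\cdots n,u}$, the sum over $u\in C^n$ with exactly $n_i$ occurrences of the color $i$ for each $i$ ($S_{\mathbf 0}=1$). $\mathbf{Sym}^{(l)}$ is the Hopf subalgebra of $\mathbf{FQSym}^{(l)}$ generated by the $S_{\mathbf n}$. For $n\ge1$ and $0\le i\le l-1$, $S_n^{(i)}=S_{n\mathbf e_i}=\mathbf G_{12\cdots n,\,i^n}$, where $\mathbf e_i$ is the $i$-th canonical basis vector of $\mathbb N^l$ (indexed from $0$). The group $\mathfrak S_n^{(l)}=(\mathbb Z/l\mathbb Z)\wr\mathfrak S_n$ is the set of colored permutations of size $n$ with multiplication $(\sigma;c_1,\dots,c_n)(\tau;d_1,\dots,d_n)=(\sigma\tau;c_{\tau(1)}+d_1,\dots,c_{\tau(n)}+d_n)$, where $(\sigma\tau)(i)=\sigma(\tau(i))$. The Mantaci–Reutenauer descent algebra of $\mathfrak S_n^{(l)}$ is the subalgebra of $\mathbb C[\mathfrak S_n^{(l)}]$ spanned by the following elements, indexed by pairs $(I,v)$ with $I=(i_1,\dots,i_m)$ a composition of $n$ and $v\in C^m$: the sum of all $(\sigma,u)\in\mathfrak S_n^{(l)}$ such that $u=v_1^{i_1}v_2^{i_2}\cdots v_m^{i_m}$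 (the first $i_1$ positions have color $v_1$, the next $i_2$ positions have color $v_2$, etc.) and $\sigma$ is increasing on each of the $m$ successive blocks of positions of lengths $i_1,\dots,i_m$. Equivalently, it is spanned by the sums of all $(\sigma,u)$ having a given color word $u$ and a given set of descents, where $k$ is a descent of $(\sigma,u)$ if $u_k\ne u_{k+1}$, or $u_k=u_{k+1}$ and $\sigma(k)>\sigma(k+1)$. *)

theory Defs
  imports
    Complex_Main
    "HOL-Library.Poly_Mapping"
    "HOL-Combinatorics.Multiset_Permutations"
    "HOL-Algebra.Group"
begin

section \<open>Free complex vector spaces\<close>

text \<open>The complex vector space with basis a set of elements of \<^typ>\<open>'a\<close> is modelled by
  finitely supported functions; the basis vector of \<open>h\<close> is \<open>basis h\<close>.\<close>

definition scale :: "complex \<Rightarrow> ('a \<Rightarrow>\<^sub>0 complex) \<Rightarrow> ('a \<Rightarrow>\<^sub>0 complex)" where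
  "scale c f = Poly_Mapping.map ((*) c) f"

lemma lookup_scale [simp]: "Poly_Mapping.lookup (scale c f) h = c * Poly_Mapping.lookup f h"
  by (simp add: scale_def map.rep_eq when_def)

global_interpretation free: vector_space scale
  by unfold_locales (auto intro!: poly_mapping_eqI simp: lookup_add algebra_simps)

definition basis :: "'a \<Rightarrow> ('a \<Rightarrow>\<^sub>0 complex)" where
  "basis h = Poly_Mapping.single h 1"

definition lin_ext :: "('a \<Rightarrow> ('b \<Rightarrow>\<^sub>0 complex)) \<Rightarrow> ('a \<Rightarrow>\<^sub>0 complex) \<Rightarrow> ('b \<Rightarrow>\<^sub>0 complex)" where
  "lin_ext g f = (\<Sum>h\<in>Poly_Mapping.keys f. scale (Poly_Mapping.lookup f h) (g h))"

definition bilin_ext ::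
  "('a \<Rightarrow> 'b \<Rightarrow> ('c \<Rightarrow>\<^sub>0 complex)) \<Rightarrow> ('a \<Rightarrow>\<^sub>0 complex) \<Rightarrow> ('b \<Rightarrow>\<^sub>0 complex) \<Rightarrow> ('c \<Rightarrow>\<^sub>0 complex)" where
  "bilin_ext g x y = lin_ext (\<lambda>a. lin_ext (g a) y) x"

text \<open>The tensor product of two such spaces has the pairs of basis elements as its basis.\<close>

definition tensor :: "('a \<Rightarrow>\<^sub>0 complex) \<Rightarrow> ('b \<Rightarrow>\<^sub>0 complex) \<Rightarrow> ('a \<times> 'b \<Rightarrow>\<^sub>0 complex)" where
  "tensor = bilin_ext (\<lambda>a b. basis (a, b))"

definition tensor_space ::
  "('a \<Rightarrow>\<^sub>0 complex) set \<Rightarrow> ('b \<Rightarrow>\<^sub>0 complex) set \<Rightarrow> ('a \<times> 'b \<Rightarrow>\<^sub>0 complex) set" where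
  "tensor_space A B = free.span {tensor a b | a b. a \<in> A \<and> b \<in> B}"


section \<open>Colored permutations\<close>

text \<open>A colored permutation is a permutation word on the letters \<open>1, \<dots>, n\<close> with a color word of
  the same length.  The colors, i.e. the elements of \<open>\<int>/l\<int>\<close>, are represented by \<open>0, \<dots>, l - 1\<close>.\<close>

type_synonym cperm = "nat list \<times> nat list"

definition color_words :: "nat \<Rightarrow> nat \<Rightarrow> nat list set" where
  "color_words l n = {u. set u \<subseteq> {..<l} \<and> length u = n}"

definition cperms :: "nat \<Rightarrow> nat \<Rightarrow> cperm set" where
  "cperms l n = permutations_of_set {1..n} \<times> color_words l n"

definition std :: "nat list \<Rightarrow> nat list" where
  "std w = map (\<lambda>x. card {y \<in> set w. y \<le> x}) w"

definition restrict_letters :: "cperm \<Rightarrow> nat \<Rightarrow> nat \<Rightarrow> cperm" where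
  "restrict_letters h a b =
     (let p = filter (\<lambda>(x, c). a \<le> x \<and> x \<le> b) (zip (fst h) (snd h))
      in (std (map fst p), map snd p))"


section \<open>The Hopf algebra FQSym\<close>

definition fqsym :: "nat \<Rightarrow> (cperm \<Rightarrow>\<^sub>0 complex) set" where
  "fqsym l = {f. Poly_Mapping.keys f \<subseteq> (\<Union>n. cperms l n)}"

abbreviation G :: "cperm \<Rightarrow> (cperm \<Rightarrow>\<^sub>0 complex)" where
  "G \<equiv> basis"

definition G_times :: "cperm \<Rightarrow> cperm \<Rightarrow> (cperm \<Rightarrow>\<^sub>0 complex)" where
  "G_times h k =
     (let p = length (fst h); q = length (fst k)
      in \<Sum>\<sigma> \<in> {\<sigma> \<in> permutations_of_set {1..p + q}. std (take p \<sigma>) = fst h \<and> std (drop p \<sigma>) = fst k}.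
           G (\<sigma>, snd h @ snd k))"

definition fq_times :: "(cperm \<Rightarrow>\<^sub>0 complex) \<Rightarrow> (cperm \<Rightarrow>\<^sub>0 complex) \<Rightarrow> (cperm \<Rightarrow>\<^sub>0 complex)" where
  "fq_times = bilin_ext G_times"

definition fq_one :: "cperm \<Rightarrow>\<^sub>0 complex" where
  "fq_one = G ([], [])"

definition fq_coprod :: "(cperm \<Rightarrow>\<^sub>0 complex) \<Rightarrow> (cperm \<times> cperm \<Rightarrow>\<^sub>0 complex)" where
  "fq_coprod = lin_ext (\<lambda>h. let n = length (fst h) in
     \<Sum>i = 0..n. tensor (G (restrict_letters h 1 i)) (G (restrict_letters h (i + 1) n)))"

definition fq_counit :: "(cperm \<Rightarrow>\<^sub>0 complex) \<Rightarrow> complex" where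
  "fq_counit f = Poly_Mapping.lookup f ([], [])"

definition convolution ::
  "((cperm \<Rightarrow>\<^sub>0 complex) \<Rightarrow> (cperm \<Rightarrow>\<^sub>0 complex)) \<Rightarrow> ((cperm \<Rightarrow>\<^sub>0 complex) \<Rightarrow> (cperm \<Rightarrow>\<^sub>0 complex)) \<Rightarrow>
   (cperm \<Rightarrow>\<^sub>0 complex) \<Rightarrow> (cperm \<Rightarrow>\<^sub>0 complex)" where
  "convolution P Q x = lin_ext (\<lambda>(h, k). fq_times (P (G h)) (Q (G k))) (fq_coprod x)"

text \<open>The values of an antipode outside \<open>fqsym l\<close> are irrelevant; on \<open>fqsym l\<close> it is unique, being
  the convolution inverse of the identity.\<close>

definition is_antipode ::
  "nat \<Rightarrow> ((cperm \<Rightarrow>\<^sub>0 complex) \<Rightarrow> (cperm \<Rightarrow>\<^sub>0 complex)) \<Rightarrow> bool" where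
  "is_antipode l S \<longleftrightarrow>
     Vector_Spaces.linear scale scale S \<and> S ` fqsym l \<subseteq> fqsym l \<and>
     (\<forall>x \<in> fqsym l. convolution S id x = scale (fq_counit x) fq_one \<and>
                     convolution id S x = scale (fq_counit x) fq_one)"

definition fq_subalgebra :: "nat \<Rightarrow> (cperm \<Rightarrow>\<^sub>0 complex) set \<Rightarrow> bool" where
  "fq_subalgebra l A \<longleftrightarrow>
     A \<subseteq> fqsym l \<and> free.subspace A \<and> fq_one \<in> A \<and> (\<forall>x \<in> A. \<forall>y \<in> A. fq_times x y \<in> A)"

definition fq_hopf_subalgebra :: "nat \<Rightarrow> (cperm \<Rightarrow>\<^sub>0 complex) set \<Rightarrow> bool" where
  "fq_hopf_subalgebra l A \<longleftrightarrow>
     fq_subalgebra l A \<and> fq_coprod ` A \<subseteq> tensor_space A A \<and>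
     (\<exists>S. is_antipode l S \<and> S ` A \<subseteq> A)"

definition fq_component :: "nat \<Rightarrow> nat \<Rightarrow> (cperm \<Rightarrow>\<^sub>0 complex) set" where
  "fq_component l n = {f. Poly_Mapping.keys f \<subseteq> cperms l n}"

definition homogeneous_part :: "nat \<Rightarrow> (cperm \<Rightarrow>\<^sub>0 complex) \<Rightarrow> (cperm \<Rightarrow>\<^sub>0 complex)" where
  "homogeneous_part n = lin_ext (\<lambda>h. if length (fst h) = n then G h else 0)"

definition is_graded :: "(cperm \<Rightarrow>\<^sub>0 complex) set \<Rightarrow> bool" where
  "is_graded A \<longleftrightarrow> (\<forall>x \<in> A. \<forall>n. homogeneous_part n x \<in> A)"


section \<open>The subalgebras Sym and MR\<close>

text \<open>The multi-index \<open>(n\<^sub>0, \<dots>, n\<^bsub>l-1\<^esub>)\<close> is a list of length \<open>l\<close>.\<close>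

definition S_complete :: "nat list \<Rightarrow> (cperm \<Rightarrow>\<^sub>0 complex)" where
  "S_complete ns =
     (let l = length ns; n = sum_list ns
      in \<Sum>u \<in> {u \<in> color_words l n. \<forall>i<l. count_list u i = ns ! i}. G ([1..<n + 1], u))"

definition S_mono :: "nat \<Rightarrow> nat \<Rightarrow> nat \<Rightarrow> (cperm \<Rightarrow>\<^sub>0 complex)" where
  "S_mono l n i = S_complete ((replicate l 0)[i := n])"

lemma S_mono_eq:
  assumes "i < l"
  shows "S_mono l n i = G ([1..<n + 1], replicate n i)"
proof -
  have "u = replicate n i" if u: "u \<in> color_words l n"
      "\<forall>j<l. count_list u j = (replicate l 0)[i := n] ! j" for u
  proof -
    have "j = i" if "j \<in> set u" for j
    proof (rule ccontr)
      assume "j \<noteq> i"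
      moreover have "j < l" using u(1) that by (auto simp: color_words_def)
      ultimately have "count_list u j = 0" using u(2) by simp
      with that show False by (simp add: count_list_0_iff)
    qed
    with u(1) show ?thesis by (auto simp: color_words_def intro!: replicate_eqI)
  qed
  moreover have "count_list (replicate n i) j = (if j = i then n else 0)" for j
    by (induction n) auto
  ultimately have "{u \<in> color_words l n. \<forall>j<l. count_list u j = (replicate l 0)[i := n] ! j}
      = {replicate n i}"
    using assms by (auto simp: color_words_def nth_list_update)
  moreover have "sum_list ((replicate l 0)[i := n]) = n"
    using assms by (simp add: sum_list_update)
  ultimately show ?thesis by (simp add: S_mono_def S_complete_def)
qed

definition Sym :: "nat \<Rightarrow> (cperm \<Rightarrow>\<^sub>0 complex) set" where
  "Sym l = fq_hopf_subalgebra l hull {S_complete ns | ns. length ns = l}"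

definition MR :: "nat \<Rightarrow> (cperm \<Rightarrow>\<^sub>0 complex) set" where
  "MR l = fq_subalgebra l hull {S_mono l n i | n i. n \<ge> 1 \<and> i < l}"


section \<open>Wreath products and the Mantaci-Reutenauer descent algebra\<close>

text \<open>Words are indexed from 0 by \<open>!\<close>, while their letters start at 1, whence the shifts by 1.\<close>

definition wreath :: "nat \<Rightarrow> nat \<Rightarrow> cperm monoid" where
  "wreath l n = \<lparr>
     carrier = cperms l n,
     mult = (\<lambda>(\<sigma>, c) (\<tau>, d).
       (map (\<lambda>i. \<sigma> ! (\<tau> ! i - 1)) [0..<n],
        map (\<lambda>i. (c ! (\<tau> ! i - 1) + d ! i) mod l) [0..<n])),
     one = ([1..<n + 1], replicate n 0)\<rparr>"

definition group_algebra :: "('g, 'b) monoid_scheme \<Rightarrow> ('g \<Rightarrow>\<^sub>0 complex) set" where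
  "group_algebra W = {f. Poly_Mapping.keys f \<subseteq> carrier W}"

definition ga_times ::
  "('g, 'b) monoid_scheme \<Rightarrow> ('g \<Rightarrow>\<^sub>0 complex) \<Rightarrow> ('g \<Rightarrow>\<^sub>0 complex) \<Rightarrow> ('g \<Rightarrow>\<^sub>0 complex)" where
  "ga_times W = bilin_ext (\<lambda>g h. basis (g \<otimes>\<^bsub>W\<^esub> h))"

definition ga_subalgebra :: "('g, 'b) monoid_scheme \<Rightarrow> ('g \<Rightarrow>\<^sub>0 complex) set \<Rightarrow> bool" where
  "ga_subalgebra W A \<longleftrightarrow>
     A \<subseteq> group_algebra W \<and> free.subspace A \<and> basis \<one>\<^bsub>W\<^esub> \<in> A \<and>
     (\<forall>x \<in> A. \<forall>y \<in> A. ga_times W x y \<in> A)"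

definition compositions :: "nat \<Rightarrow> nat list set" where
  "compositions n = {I. (\<forall>i \<in> set I. 0 < i) \<and> sum_list I = n}"

definition block :: "nat list \<Rightarrow> nat \<Rightarrow> 'a list \<Rightarrow> 'a list" where
  "block I k w = take (I ! k) (drop (sum_list (take k I)) w)"

definition mr_element :: "nat \<Rightarrow> nat \<Rightarrow> nat list \<Rightarrow> nat list \<Rightarrow> (cperm \<Rightarrow>\<^sub>0 complex)" where
  "mr_element l n I v =
     (\<Sum>h \<in> {(\<sigma>, u) \<in> carrier (wreath l n).
               u = concat (map2 replicate I v) \<and> (\<forall>k < length I. sorted_wrt (<) (block I k \<sigma>))}.
        basis h)"

definition mr_descent_algebra :: "nat \<Rightarrow> nat \<Rightarrow> (cperm \<Rightarrow>\<^sub>0 complex) set" where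
  "mr_descent_algebra l n =
     free.span {mr_element l n I v | I v. I \<in> compositions n \<and> v \<in> color_words l (length I)}"

text \<open>The group \<open>wreath l n\<close> is by definition carried by the set \<open>cperms l n\<close> that indexes the
  degree \<open>n\<close> part of the basis \<open>G\<close>, so the linear map \<open>G h \<mapsto> h\<close> goes between spaces of the same type.\<close>

definition identification :: "(cperm \<Rightarrow>\<^sub>0 complex) \<Rightarrow> (cperm \<Rightarrow>\<^sub>0 complex)" where
  "identification = lin_ext (\<lambda>h. basis h)"

end

theory Submission
  imports Defs
begin

text \<open>For a color word \<open>e\<close> and a set \<open>R\<close> of positions \<open>k\<close> with \<open>e\<^sub>k = e\<^bsub>k+1\<^esub>\<close>, consider the sum of all
  \<open>G\<^bsub>\<sigma>,e\<^esub>\<close> with \<open>\<sigma>\<^sub>k < \<sigma>\<^bsub>k+1\<^esub>\<close> for all \<open>k \<in> R\<close>; recording the blocks of a composition by the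
  set of positions at which two letters of the same block meet, these are the Mantaci-Reutenauer
  elements.  The product of two of them is the one of the concatenated data, so they are exactly the
  products of the \<open>S\<^sub>n\<^sup>(\<^sup>i\<^sup>)\<close> and span \<open>MR\<close>.  In the coproduct, fix the set of positions of the small
  letters: the pairs of restrictions then range freely over two such sums.  The antipode of \<open>FQSym\<close>
  comes from the left recursion of a graded connected coalgebra; that it is also a right inverse
  only needs associativity and the compatibility of successive restrictions, and the coproduct
  formula shows that it preserves \<open>MR\<close>.  In the group algebra, the products \<open>\<sigma>\<tau>\<close> are sorted by the
  word of the blocks of \<open>\<sigma>\<close> visited by \<open>\<tau>\<close>; for each such word \<open>x\<close> they run over one of the sums
  above, because \<open>\<tau>\<close> is recovered from \<open>\<rho> = \<sigma>\<tau>\<close> by standardizing the pairs \<open>(x\<^sub>i, \<rho>\<^sub>i)\<close>.\<close>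

section \<open>Free vector spaces\<close>

text \<open>Summing over any finite set containing the support lets two vectors with different
  supports be treated over one common index set, as in \<open>lin_ext_add\<close>.\<close>

lemma lin_ext_eq:
  assumes "finite K" "Poly_Mapping.keys f \<subseteq> K"
  shows "lin_ext g f = (\<Sum>h\<in>K. scale (Poly_Mapping.lookup f h) (g h))"
  unfolding lin_ext_def using assms
  by (intro sum.mono_neutral_left) (auto simp: in_keys_iff)

lemma lin_ext_add: "lin_ext g (x + y) = lin_ext g x + lin_ext g y"
proof -
  let ?K = "Poly_Mapping.keys x \<union> Poly_Mapping.keys y"
  have "lin_ext g z = (\<Sum>h\<in>?K. scale (Poly_Mapping.lookup z h) (g h))"
    if "Poly_Mapping.keys z \<subseteq> ?K" for z
    using that by (intro lin_ext_eq) auto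
  then show ?thesis
    using Poly_Mapping.keys_add[of x y]
    by (simp add: lookup_add free.scale_left_distrib sum.distrib)
qed

lemma lin_ext_scale: "lin_ext g (scale c x) = scale c (lin_ext g x)"
proof -
  have "Poly_Mapping.keys (scale c x) \<subseteq> Poly_Mapping.keys x"
    by (auto simp: in_keys_iff)
  then have "lin_ext g (scale c x)
      = (\<Sum>h\<in>Poly_Mapping.keys x. scale (Poly_Mapping.lookup (scale c x) h) (g h))"
    by (intro lin_ext_eq) auto
  then show ?thesis by (simp add: lin_ext_def free.scale_sum_right)
qed

lemma linear_lin_ext: "Vector_Spaces.linear scale scale (lin_ext g)"
  by unfold_locales (auto simp: lin_ext_add lin_ext_scale)

lemma lin_ext_0 [simp]: "lin_ext g 0 = 0"
  by (simp add: lin_ext_def)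

lemma lin_ext_sum: "lin_ext g (sum x A) = (\<Sum>a\<in>A. lin_ext g (x a))"
  by (induction A rule: infinite_finite_induct) (auto simp: lin_ext_add)

lemma lin_ext_basis [simp]: "lin_ext g (basis h) = g h"
  by (simp add: lin_ext_def basis_def)

lemma lin_ext_basis_id [simp]: "lin_ext basis x = x"
proof (rule poly_mapping_eqI)
  fix h
  have "Poly_Mapping.lookup (lin_ext basis x) h
      = (\<Sum>k\<in>Poly_Mapping.keys x. Poly_Mapping.lookup x k * Poly_Mapping.lookup (basis k) h)"
    by (simp add: lin_ext_def lookup_sum)
  also have "\<dots> = Poly_Mapping.lookup x h"
    by (simp add: basis_def lookup_single when_def in_keys_iff if_distrib cong: if_cong)
  finally show "Poly_Mapping.lookup (lin_ext basis x) h = Poly_Mapping.lookup x h" .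
qed

text \<open>The case \<open>scale\<close> concerns only keys of the original \<open>f\<close>, so a
  hypothesis on the support of \<open>f\<close>, such as membership in \<open>fqsym l\<close>,
  remains available there.\<close>

lemma free_induct [case_names zero add scale]:
  assumes "P 0" "\<And>x y. P x \<Longrightarrow> P y \<Longrightarrow> P (x + y)"
    and "\<And>c h. h \<in> Poly_Mapping.keys f \<Longrightarrow> P (scale c (basis h))"
  shows "P f"
proof -
  have "P (\<Sum>h\<in>A. scale (Poly_Mapping.lookup f h) (basis h))"
    if "finite A" "A \<subseteq> Poly_Mapping.keys f" for A
    using that by (induction rule: finite_induct) (auto intro: assms)
  from this[of "Poly_Mapping.keys f"] show ?thesis
    using lin_ext_basis_id[of f] by (simp add: lin_ext_def)
qed

lemma keys_basis [simp]: "Poly_Mapping.keys (basis h) = {h}"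
  by (simp add: basis_def)

lemma keys_in_span:
  assumes "Poly_Mapping.keys f \<subseteq> A"
  shows "f \<in> free.span (basis ` A)"
proof (induction f rule: free_induct)
  case (scale c h)
  then have "basis h \<in> basis ` A" using assms by auto
  then show ?case by (intro free.span_scale free.span_base)
qed (simp_all add: free.span_zero free.span_add)

lemma subspace_keys: "free.subspace {f. Poly_Mapping.keys f \<subseteq> A}"
proof -
  have *: "{f. Poly_Mapping.keys f \<subseteq> A} = {f. \<forall>h. h \<notin> A \<longrightarrow> Poly_Mapping.lookup f h = 0}"
    by (auto simp: in_keys_iff)
  show ?thesis unfolding * by (simp add: free.subspace_def lookup_add)
qed

lemma lin_ext_span:
  assumes "\<And>a. a \<in> A \<Longrightarrow> lin_ext g a \<in> C" "free.subspace C" "x \<in> free.span A"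
  shows "lin_ext g x \<in> C"
  using assms(3,1)
  by (induction rule: free.span_induct_alt)
     (auto simp: lin_ext_add lin_ext_scale intro!: free.subspace_add free.subspace_scale free.subspace_0 assms(2))

lemma bilin_ext_add_left: "bilin_ext g (x + y) z = bilin_ext g x z + bilin_ext g y z"
  by (simp add: bilin_ext_def lin_ext_add)

lemma bilin_ext_scale_left: "bilin_ext g (scale c x) z = scale c (bilin_ext g x z)"
  by (simp add: bilin_ext_def lin_ext_scale)

lemma bilin_ext_add_right: "bilin_ext g x (y + z) = bilin_ext g x y + bilin_ext g x z"
  by (simp add: bilin_ext_def lin_ext_def[of _ x] lin_ext_add free.scale_right_distrib sum.distrib)

lemma bilin_ext_scale_right: "bilin_ext g x (scale c y) = scale c (bilin_ext g x y)"
  by (simp add: bilin_ext_def lin_ext_def[of _ x] lin_ext_scale free.scale_sum_right mult.commute)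

lemma bilin_ext_0_left [simp]: "bilin_ext g 0 y = 0"
  by (simp add: bilin_ext_def)

lemma bilin_ext_0_right [simp]: "bilin_ext g x 0 = 0"
  by (simp add: bilin_ext_def lin_ext_def[of _ x])

lemma bilin_ext_sum_left: "bilin_ext g (sum x A) y = (\<Sum>a\<in>A. bilin_ext g (x a) y)"
  by (simp add: bilin_ext_def lin_ext_sum)

lemma bilin_ext_sum_right: "bilin_ext g x (sum y A) = (\<Sum>a\<in>A. bilin_ext g x (y a))"
  by (induction A rule: infinite_finite_induct) (auto simp: bilin_ext_add_right)

lemma bilin_ext_basis [simp]: "bilin_ext g (basis a) (basis b) = g a b"
  by (simp add: bilin_ext_def)

text \<open>Linearity is used first in the right argument and then in the left one. This reduces
  closure under a product to the products of spanning elements.\<close>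

lemma bilin_ext_span:
  assumes "\<And>a b. a \<in> A \<Longrightarrow> b \<in> B \<Longrightarrow> bilin_ext g a b \<in> C" "free.subspace C"
    and "x \<in> free.span A" "y \<in> free.span B"
  shows "bilin_ext g x y \<in> C"
proof -
  have "bilin_ext g a y \<in> C" if "a \<in> A" for a
    using assms(4)
    by (induction rule: free.span_induct_alt)
       (auto simp: bilin_ext_add_right bilin_ext_scale_right that
          intro!: free.subspace_add free.subspace_scale free.subspace_0 assms(1,2))
  with assms(3) show ?thesis
    by (induction rule: free.span_induct_alt)
       (auto simp: bilin_ext_add_left bilin_ext_scale_left
          intro!: free.subspace_add free.subspace_scale free.subspace_0 assms(2))
qed

section \<open>Standardization\<close>

lemma length_std [simp]: "length (std w) = length w"
  by (simp add: std_def)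

text \<open>Distinct letters correspond to positions, so counting letters becomes counting
  positions; in this form \<open>std\<close> visibly depends only on the comparisons between
  positions.\<close>

lemma std_nth:
  assumes "distinct w" "i < length w"
  shows "std w ! i = card {j. j < length w \<and> w ! j \<le> w ! i}"
proof -
  have "{y \<in> set w. y \<le> w ! i} = (!) w ` {j. j < length w \<and> w ! j \<le> w ! i}"
    by (auto simp: in_set_conv_nth)
  moreover have "inj_on ((!) w) {j. j < length w \<and> w ! j \<le> w ! i}"
    using assms(1) by (auto intro!: inj_onI simp: nth_eq_iff_index_eq)
  ultimately show ?thesis using assms(2) by (simp add: std_def card_image)
qed

lemma std_cong:
  assumes "distinct v" "distinct w" "length v = length w"
    and "\<And>i j. i < length w \<Longrightarrow> j < length w \<Longrightarrow> v ! i \<le> v ! j \<longleftrightarrow> w ! i \<le> w ! j"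
  shows "std v = std w"
proof (rule nth_equalityI)
  fix i assume "i < length (std v)"
  then have i: "i < length w" using assms(3) by simp
  have "{j. j < length v \<and> v ! j \<le> v ! i} = {j. j < length w \<and> w ! j \<le> w ! i}"
    using assms(3,4) i by auto
  then show "std v ! i = std w ! i" using assms i by (simp add: std_nth)
qed (use assms in simp)

text \<open>A letter \<open>b\<close> of \<open>w\<close> is counted at \<open>b\<close> but not at
  any smaller \<open>a\<close>, so the count is strictly increasing on the letters of
  \<open>w\<close>.\<close>

lemma std_le_iff:
  assumes "i < length w" "j < length w"
  shows "std w ! i \<le> std w ! j \<longleftrightarrow> w ! i \<le> w ! j"
proof -
  have "card {y \<in> set w. y \<le> a} < card {y \<in> set w. y \<le> b}" if "a < b" "b \<in> set w" for a b
    proof (rule psubset_card_mono)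
      have "b \<in> {y \<in> set w. y \<le> b}" "b \<notin> {y \<in> set w. y \<le> a}" using that by auto
      then have "{y \<in> set w. y \<le> a} \<noteq> {y \<in> set w. y \<le> b}" by metis
      then show "{y \<in> set w. y \<le> a} \<subset> {y \<in> set w. y \<le> b}" using that(1) by force
    qed simp
  moreover have "card {y \<in> set w. y \<le> a} \<le> card {y \<in> set w. y \<le> b}" if "a \<le> b" for a b
    using that by (intro card_mono) auto
  ultimately show ?thesis
    using assms by (auto simp: std_def) (metis leD not_le_imp_less nth_mem)
qed

lemma std_less_iff: "i < length w \<Longrightarrow> j < length w \<Longrightarrow> std w ! i < std w ! j \<longleftrightarrow> w ! i < w ! j"
  using std_le_iff[of j w i] by (simp add: not_le[symmetric])

section \<open>Permutation words and their standardization\<close>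

definition perms :: "nat \<Rightarrow> nat list set" where
  "perms n = permutations_of_set {1..n}"

lemma finite_perms [simp]: "finite (perms n)"
  by (simp add: perms_def)

lemma permsD:
  assumes "\<sigma> \<in> perms n"
  shows "distinct \<sigma>" "set \<sigma> = {1..n}" "length \<sigma> = n"
  using assms distinct_card[of \<sigma>] by (auto simp: perms_def permutations_of_set_def)

lemma permsI: "distinct \<sigma> \<Longrightarrow> set \<sigma> \<subseteq> {1..length \<sigma>} \<Longrightarrow> \<sigma> \<in> perms (length \<sigma>)"
  using card_subset_eq[of "{1..length \<sigma>}" "set \<sigma>"] distinct_card[of \<sigma>]
  by (auto simp: perms_def permutations_of_set_def)

lemma distinct_std:
  assumes "distinct w"
  shows "distinct (std w)"
  unfolding distinct_conv_nth
proof (intro allI impI)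
  fix i j assume ij: "i < length (std w)" "j < length (std w)" "i \<noteq> j"
  then have "w ! i \<noteq> w ! j" using assms by (simp add: nth_eq_iff_index_eq)
  then show "std w ! i \<noteq> std w ! j"
    using ij std_less_iff[of i w j] std_less_iff[of j w i] by (cases "w ! i" "w ! j" rule: linorder_cases) auto
qed

lemma std_perms:
  assumes "distinct w"
  shows "std w \<in> perms (length w)"
proof -
  have "set (std w) \<subseteq> {1..length w}"
  proof
    fix c assume "c \<in> set (std w)"
    then obtain x where x: "x \<in> set w" "c = card {y \<in> set w. y \<le> x}" by (auto simp: std_def)
    have "{y \<in> set w. y \<le> x} \<noteq> {}" using x(1) by auto
    then have "c \<noteq> 0" using x(2) by simp
    moreover have "c \<le> card (set w)" unfolding x(2) by (intro card_mono) auto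
    ultimately show "c \<in> {1..length w}" using card_length[of w] by simp
  qed
  then show ?thesis using permsI[of "std w"] distinct_std[OF assms] by simp
qed

lemma std_id: "\<sigma> \<in> perms n \<Longrightarrow> std \<sigma> = \<sigma>"
proof -
  assume \<sigma>: "\<sigma> \<in> perms n"
  have "card {y \<in> {1..n}. y \<le> x} = x" if "x \<in> {1..n}" for x
  proof -
    have "{y \<in> {1..n}. y \<le> x} = {1..x}" using that by auto
    then show ?thesis by simp
  qed
  then show ?thesis using permsD[OF \<sigma>] unfolding std_def by (intro map_idI) auto
qed

text \<open>Standardizing preserves all comparisons, so it may be done before or after cutting. With
  \<open>std_drop\<close> this is what makes the product associative.\<close>

lemma std_take: "distinct w \<Longrightarrow> std (take p (std w)) = std (take p w)"
  by (rule std_cong) (auto simp: distinct_std std_le_iff)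

lemma std_drop: "distinct w \<Longrightarrow> std (drop p (std w)) = std (drop p w)"
  by (rule std_cong) (auto simp: distinct_std std_le_iff)

section \<open>The product of FQSym\<close>

lemma fq_times_basis [simp]: "fq_times (G h) (G k) = G_times h k"
  by (simp add: fq_times_def)

lemma fq_times_add_left: "fq_times (x + y) z = fq_times x z + fq_times y z"
  and fq_times_add_right: "fq_times x (y + z) = fq_times x y + fq_times x z"
  and fq_times_scale_left: "fq_times (scale c x) y = scale c (fq_times x y)"
  and fq_times_scale_right: "fq_times x (scale c y) = scale c (fq_times x y)"
  and fq_times_0_left [simp]: "fq_times 0 y = 0"
  and fq_times_0_right [simp]: "fq_times x 0 = 0"
  and fq_times_sum_left: "fq_times (sum f A) y = (\<Sum>a\<in>A. fq_times (f a) y)"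
  and fq_times_sum_right: "fq_times x (sum f A) = (\<Sum>a\<in>A. fq_times x (f a))"
  by (simp_all add: fq_times_def bilin_ext_add_left bilin_ext_add_right bilin_ext_scale_left
        bilin_ext_scale_right bilin_ext_sum_left bilin_ext_sum_right)

text \<open>The outer index is determined by the inner one through \<open>f\<close>. This flattens
  the nested sums that arise when a product is multiplied again.\<close>

lemma sum_fibers:
  assumes "finite A" "finite B"
  shows "(\<Sum>b\<in>{b \<in> B. Q b}. \<Sum>a\<in>{a \<in> A. f a = b \<and> R a}. g a)
       = (\<Sum>a\<in>{a \<in> A. f a \<in> B \<and> Q (f a) \<and> R a}. g a)"
proof -
  have "(\<Sum>a\<in>{a \<in> A. f a \<in> B \<and> Q (f a) \<and> R a}. g a)
     = (\<Sum>b\<in>{b \<in> B. Q b}. \<Sum>a\<in>{a' \<in> {a \<in> A. f a \<in> B \<and> Q (f a) \<and> R a}. f a' = b}. g a)"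
    using assms by (intro sum.group[symmetric]) auto
  also have "\<dots> = (\<Sum>b\<in>{b \<in> B. Q b}. \<Sum>a\<in>{a \<in> A. f a = b \<and> R a}. g a)"
    by (intro sum.cong refl) auto
  finally show ?thesis by simp
qed

lemma G_times_eq:
  "G_times h k = (\<Sum>\<sigma>\<in>{\<sigma> \<in> perms (length (fst h) + length (fst k)).
     std (take (length (fst h)) \<sigma>) = fst h \<and> std (drop (length (fst h)) \<sigma>) = fst k}.
     G (\<sigma>, snd h @ snd k))"
  by (simp add: G_times_def Let_def perms_def)

text \<open>Both bracketings are compared with the sum over all words cut into three pieces that
  standardize to \<open>fst g\<close>, \<open>fst h\<close> and \<open>fst k\<close>. The
  permutation of the intermediate product is the standardization of a prefix or a suffix of the
  final word.\<close>

lemma fq_times_assoc_basis: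
  "fq_times (fq_times (G g) (G h)) (G k) = fq_times (G g) (fq_times (G h) (G k))"
proof -
  let ?p = "length (fst g)" and ?q = "length (fst h)" and ?r = "length (fst k)"
  let ?u = "snd g @ snd h @ snd k"
  let ?L = "\<Sum>\<sigma>\<in>{\<sigma> \<in> perms (?p + ?q + ?r). std (take ?p \<sigma>) = fst g \<and>
      std (take ?q (drop ?p \<sigma>)) = fst h \<and> std (drop (?p + ?q) \<sigma>) = fst k}. G (\<sigma>, ?u)"
  have "fq_times (fq_times (G g) (G h)) (G k)
     = (\<Sum>\<rho>\<in>{\<rho> \<in> perms (?p + ?q). std (take ?p \<rho>) = fst g \<and> std (drop ?p \<rho>) = fst h}.
        \<Sum>\<sigma>\<in>{\<sigma> \<in> perms (?p + ?q + ?r). std (take (?p + ?q) \<sigma>) = \<rho> \<and>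
           std (drop (?p + ?q) \<sigma>) = fst k}. G (\<sigma>, ?u))"
    unfolding fq_times_basis G_times_eq[of g] fq_times_sum_left
    by (intro sum.cong refl) (auto simp: G_times_eq dest: permsD(3))
  also have "\<dots> = ?L"
  proof (subst sum_fibers)
    \<comment> \<open>The membership condition introduced by \<open>sum_fibers\<close> holds for
      every \<open>\<sigma>\<close>, and the conditions on the standardized prefix become conditions
      on pieces of \<open>\<sigma>\<close>.\<close>
    have "std (take (?p + ?q) \<sigma>) \<in> perms (?p + ?q)
       \<and> std (take ?p (std (take (?p + ?q) \<sigma>))) = std (take ?p \<sigma>)
       \<and> std (drop ?p (std (take (?p + ?q) \<sigma>))) = std (take ?q (drop ?p \<sigma>))"
      if "\<sigma> \<in> perms (?p + ?q + ?r)" for \<sigma>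
      using permsD[OF that] std_perms[of "take (?p + ?q) \<sigma>"]
      by (simp add: std_take std_drop min_absorb1 drop_take)
    then show "sum (\<lambda>\<sigma>. G (\<sigma>, ?u)) {\<sigma> \<in> perms (?p + ?q + ?r).
        std (take (?p + ?q) \<sigma>) \<in> perms (?p + ?q) \<and>
        (std (take ?p (std (take (?p + ?q) \<sigma>))) = fst g \<and> std (drop ?p (std (take (?p + ?q) \<sigma>))) = fst h) \<and>
        std (drop (?p + ?q) \<sigma>) = fst k} = ?L"
      by (intro sum.cong refl Collect_cong) auto
  qed auto
  finally have 1: "fq_times (fq_times (G g) (G h)) (G k) = ?L" .
  have "fq_times (G g) (fq_times (G h) (G k))
     = (\<Sum>\<rho>\<in>{\<rho> \<in> perms (?q + ?r). std (take ?q \<rho>) = fst h \<and> std (drop ?q \<rho>) = fst k}.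
        \<Sum>\<sigma>\<in>{\<sigma> \<in> perms (?p + ?q + ?r). std (drop ?p \<sigma>) = \<rho> \<and>
           std (take ?p \<sigma>) = fst g}. G (\<sigma>, ?u))"
    unfolding fq_times_basis G_times_eq[of h] fq_times_sum_right
    by (intro sum.cong refl) (auto simp: G_times_eq add.assoc conj_ac dest: permsD(3))
  also have "\<dots> = ?L"
  proof (subst sum_fibers)
    have "std (drop ?p \<sigma>) \<in> perms (?q + ?r)
       \<and> std (take ?q (std (drop ?p \<sigma>))) = std (take ?q (drop ?p \<sigma>))
       \<and> std (drop ?q (std (drop ?p \<sigma>))) = std (drop (?p + ?q) \<sigma>)"
      if "\<sigma> \<in> perms (?p + ?q + ?r)" for \<sigma>
      using permsD[OF that] std_perms[of "drop ?p \<sigma>"]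
      by (simp add: std_take std_drop add.commute)
    then show "sum (\<lambda>\<sigma>. G (\<sigma>, ?u)) {\<sigma> \<in> perms (?p + ?q + ?r).
        std (drop ?p \<sigma>) \<in> perms (?q + ?r) \<and>
        (std (take ?q (std (drop ?p \<sigma>))) = fst h \<and> std (drop ?q (std (drop ?p \<sigma>))) = fst k) \<and>
        std (take ?p \<sigma>) = fst g} = ?L"
      by (intro sum.cong refl Collect_cong) auto
  qed auto
  finally show ?thesis using 1 by simp
qed

lemma fq_times_assoc: "fq_times (fq_times x y) z = fq_times x (fq_times y z)"
proof (induction x rule: free_induct)
  case (scale c g)
  show ?case
  proof (induction y rule: free_induct)
    case (scale d h)
    show ?case
      by (induction z rule: free_induct)
         (simp_all only: fq_times_add_left fq_times_add_right fq_times_scale_left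
            fq_times_scale_right fq_times_assoc_basis fq_times_0_left fq_times_0_right)
  qed (simp_all add: fq_times_add_left fq_times_add_right)
qed (simp_all add: fq_times_add_left)

text \<open>A permutation word is its own standardization, so the sum defining the product has the
  single term \<open>fst h\<close>.\<close>

lemma fq_one_left:
  assumes "fst h \<in> perms n"
  shows "fq_times fq_one (G h) = G h" "fq_times (G h) fq_one = G h"
proof -
  have "{\<sigma> \<in> perms n. std [] = [] \<and> std \<sigma> = fst h} = {fst h}"
    using assms std_id by (auto simp: std_def[of "[]"])
  then show "fq_times fq_one (G h) = G h" using permsD[OF assms]
    by (simp add: fq_one_def G_times_eq)
  have "{\<sigma> \<in> perms n. std (take n \<sigma>) = fst h \<and> std (drop n \<sigma>) = []} = {fst h}"
    using assms std_id by (auto simp: permsD(3) std_def[of "[]"])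
  then show "fq_times (G h) fq_one = G h" using permsD[OF assms]
    by (simp add: fq_one_def G_times_eq)
qed

lemma fq_times_one_left: "x \<in> fqsym l \<Longrightarrow> fq_times fq_one x = x"
  and fq_times_one_right: "x \<in> fqsym l \<Longrightarrow> fq_times x fq_one = x"
proof -
  assume "x \<in> fqsym l"
  then have 0: "fst h \<in> perms (length (fst h))" if "h \<in> Poly_Mapping.keys x" for h
    using that permsD(3) by (fastforce simp: fqsym_def cperms_def perms_def)
  then have *: "fq_times fq_one (G h) = G h" "fq_times (G h) fq_one = G h"
    if "h \<in> Poly_Mapping.keys x" for h
    using fq_one_left[OF 0[OF that]] by auto
  have "fq_times fq_one x = x \<and> fq_times x fq_one = x"
    by (induction x rule: free_induct)
       (simp_all add: fq_times_add_left fq_times_add_right fq_times_scale_left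
         fq_times_scale_right *)
  then show "fq_times fq_one x = x" "fq_times x fq_one = x" by auto
qed

section \<open>Sums over words increasing at prescribed positions\<close>

text \<open>The relation is a parameter because three instances occur: \<open>(<)\<close> for
  letters, \<open>(=)\<close> for colors, and an implication for Boolean position patterns.
  Positions without a successor in the word are ignored, so only part of \<open>R\<close>
  matters.\<close>

definition chain :: "('a \<Rightarrow> 'a \<Rightarrow> bool) \<Rightarrow> nat set \<Rightarrow> 'a list \<Rightarrow> bool" where
  "chain P R w \<longleftrightarrow> (\<forall>k\<in>R. Suc k < length w \<longrightarrow> P (w ! k) (w ! Suc k))"

lemma chain_cong:
  "(\<And>k. Suc k < length w \<Longrightarrow> k \<in> R \<longleftrightarrow> k \<in> R') \<Longrightarrow> chain P R w \<longleftrightarrow> chain P R' w"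
  by (auto simp: chain_def)

lemma chain_Nil [simp]: "chain P R []"
  by (simp add: chain_def)

lemma all_nat_split: "(\<forall>k. Q k) \<longleftrightarrow> Q 0 \<and> (\<forall>k. Q (Suc k))"
  by (metis not0_implies_Suc)

lemma chain_Cons:
  "chain P R (x # w) \<longleftrightarrow> (0 \<in> R \<longrightarrow> w \<noteq> [] \<longrightarrow> P x (hd w)) \<and> chain P {k. Suc k \<in> R} w"
proof -
  have "chain P R (x # w) \<longleftrightarrow>
      (\<forall>k. k \<in> R \<longrightarrow> Suc k < length (x # w) \<longrightarrow> P ((x # w) ! k) ((x # w) ! Suc k))"
    by (auto simp: chain_def)
  also have "\<dots> \<longleftrightarrow> (0 \<in> R \<longrightarrow> w \<noteq> [] \<longrightarrow> P x (hd w)) \<and> chain P {k. Suc k \<in> R} w"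
    by (subst all_nat_split) (auto simp: chain_def hd_conv_nth)
  finally show ?thesis .
qed

text \<open>The positions \<open>p - 1\<close> and \<open>p\<close> of a concatenation whose first factor has length \<open>p\<close> are not linked,
  hence the strict bound.\<close>

definition join :: "nat \<Rightarrow> nat set \<Rightarrow> nat set \<Rightarrow> nat set" where
  "join p A B = {k \<in> A. Suc k < p} \<union> (+) p ` B"

lemma chain_append: "chain P (join (length u) A B) (u @ v) \<longleftrightarrow> chain P A u \<and> chain P B v"
proof -
  have "chain P (join (length u) A B) (u @ v) \<longleftrightarrow>
      (\<forall>k\<in>A. Suc k < length u \<longrightarrow> P ((u @ v) ! k) ((u @ v) ! Suc k)) \<and>
      (\<forall>k\<in>B. Suc k < length v \<longrightarrow> P ((u @ v) ! (length u + k)) ((u @ v) ! Suc (length u + k)))"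
    unfolding chain_def join_def ball_Un by auto
  also have "\<dots> \<longleftrightarrow> chain P A u \<and> chain P B v"
    by (auto simp: chain_def nth_append)
  finally show ?thesis .
qed

lemma chain_std: "chain (<) R (std w) \<longleftrightarrow> chain (<) R w"
  by (auto simp: chain_def std_less_iff)

definition inc_words :: "nat set \<Rightarrow> nat \<Rightarrow> nat list set" where
  "inc_words R n = {\<sigma> \<in> perms n. chain (<) R \<sigma>}"

definition inc_sum :: "nat set \<Rightarrow> nat list \<Rightarrow> (cperm \<Rightarrow>\<^sub>0 complex)" where
  "inc_sum R e = (\<Sum>\<sigma>\<in>inc_words R (length e). G (\<sigma>, e))"

lemma finite_inc_words [simp]: "finite (inc_words R n)"
  by (simp add: inc_words_def)

lemma inc_words_cong:
  "(\<And>k. Suc k < n \<Longrightarrow> k \<in> R \<longleftrightarrow> k \<in> R') \<Longrightarrow> inc_words R n = inc_words R' n"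
  unfolding inc_words_def
  by (intro Collect_cong conj_cong refl chain_cong) (simp add: permsD(3))

lemma inc_sum_cong:
  "(\<And>k. Suc k < length e \<Longrightarrow> k \<in> R \<longleftrightarrow> k \<in> R') \<Longrightarrow> inc_sum R e = inc_sum R' e"
  unfolding inc_sum_def using inc_words_cong[of "length e" R R'] by simp

text \<open>Each word of the product lies over exactly one pair of factors, the standardizations of
  its two parts. Standardization keeps comparisons, so the conditions on the factors are conditions
  on the parts, and \<open>chain_append\<close> combines them.\<close>

lemma inc_sum_times:
  "fq_times (inc_sum A u) (inc_sum B v) = inc_sum (join (length u) A B) (u @ v)"
proof -
  let ?p = "length u" and ?q = "length v"
  let ?f = "\<lambda>\<sigma>. (std (take ?p \<sigma>), std (drop ?p \<sigma>))"
  let ?Q = "\<lambda>(\<alpha>, \<beta>). chain (<) A \<alpha> \<and> chain (<) B \<beta>"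
  have *: "{ab \<in> perms ?p \<times> perms ?q. ?Q ab} = inc_words A ?p \<times> inc_words B ?q"
    by (auto simp: inc_words_def)
  have "fq_times (inc_sum A u) (inc_sum B v)
      = (\<Sum>\<alpha>\<in>inc_words A ?p. \<Sum>\<beta>\<in>inc_words B ?q. G_times (\<alpha>, u) (\<beta>, v))"
    by (simp add: inc_sum_def fq_times_sum_left fq_times_sum_right)
       (rule sum.swap)
  also have "\<dots> = (\<Sum>(\<alpha>, \<beta>)\<in>inc_words A ?p \<times> inc_words B ?q. G_times (\<alpha>, u) (\<beta>, v))"
    by (simp add: sum.cartesian_product)
  \<comment> \<open>The conjunct \<open>True\<close> fills the additional condition \<open>R\<close>
    of \<open>sum_fibers\<close>.\<close>
  also have "\<dots> = (\<Sum>ab\<in>{ab \<in> perms ?p \<times> perms ?q. ?Q ab}.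
      \<Sum>\<sigma>\<in>{\<sigma> \<in> perms (?p + ?q). ?f \<sigma> = ab \<and> True}. G (\<sigma>, u @ v))"
    unfolding * by (intro sum.cong refl) (auto simp: G_times_eq inc_words_def permsD(3))
  also have "\<dots> = (\<Sum>\<sigma>\<in>{\<sigma> \<in> perms (?p + ?q). ?f \<sigma> \<in> perms ?p \<times> perms ?q \<and> ?Q (?f \<sigma>) \<and> True}.
      G (\<sigma>, u @ v))"
    by (rule sum_fibers) simp_all
  also have "{\<sigma> \<in> perms (?p + ?q). ?f \<sigma> \<in> perms ?p \<times> perms ?q \<and> ?Q (?f \<sigma>) \<and> True}
      = inc_words (join ?p A B) (length (u @ v))"
  proof -
    have "?f \<sigma> \<in> perms ?p \<times> perms ?q \<and> (?Q (?f \<sigma>) \<longleftrightarrow> chain (<) (join ?p A B) \<sigma>)"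
      if "\<sigma> \<in> perms (?p + ?q)" for \<sigma>
      using permsD[OF that] std_perms[of "take ?p \<sigma>"] std_perms[of "drop ?p \<sigma>"]
        chain_append[of "(<)" "take ?p \<sigma>" A B "drop ?p \<sigma>"]
      by (simp add: chain_std min_absorb1)
    then show ?thesis unfolding inc_words_def length_append by (intro Collect_cong) blast
  qed
  finally show ?thesis by (simp add: inc_sum_def)
qed

lemma perms_0 [simp]: "perms 0 = {[]}"
  by (simp add: perms_def)

lemma inc_sum_Nil [simp]: "inc_sum R [] = fq_one"
proof -
  have "inc_words R 0 = {[]}" by (auto simp: inc_words_def)
  then show ?thesis by (simp add: inc_sum_def fq_one_def)
qed

section \<open>Membership in \<open>fqsym\<close> and in its graded components\<close>

lemma cperms_iff: "(\<sigma>, u) \<in> cperms l n \<longleftrightarrow> \<sigma> \<in> perms n \<and> set u \<subseteq> {..<l} \<and> length u = n"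
  by (simp add: cperms_def perms_def color_words_def)

lemma fqsym_G: "h \<in> cperms l n \<Longrightarrow> G h \<in> fqsym l"
  by (auto simp: fqsym_def)

lemma subspace_fqsym: "free.subspace (fqsym l)"
  unfolding fqsym_def by (rule subspace_keys)

lemma fqsym_span: "x \<in> fqsym l \<Longrightarrow> x \<in> free.span (G ` (\<Union>n. cperms l n))"
  unfolding fqsym_def by (intro keys_in_span) simp

lemma G_times_fqsym:
  assumes "h \<in> cperms l m" "k \<in> cperms l n"
  shows "G_times h k \<in> fqsym l"
  unfolding G_times_eq
proof (rule free.subspace_sum[OF subspace_fqsym])
  fix \<sigma> assume "\<sigma> \<in> {\<sigma> \<in> perms (length (fst h) + length (fst k)).
     std (take (length (fst h)) \<sigma>) = fst h \<and> std (drop (length (fst h)) \<sigma>) = fst k}"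
  moreover obtain \<alpha> u \<beta> v where "h = (\<alpha>, u)" "k = (\<beta>, v)" by fastforce
  ultimately have "(\<sigma>, snd h @ snd k) \<in> cperms l (m + n)"
    using assms permsD(3)[of \<alpha> m] permsD(3)[of \<beta> n] by (simp add: cperms_iff)
  then show "G (\<sigma>, snd h @ snd k) \<in> fqsym l" by (rule fqsym_G)
qed

lemma fq_times_fqsym: "x \<in> fqsym l \<Longrightarrow> y \<in> fqsym l \<Longrightarrow> fq_times x y \<in> fqsym l"
  unfolding fq_times_def
  by (rule bilin_ext_span[OF _ subspace_fqsym fqsym_span fqsym_span]) (auto intro: G_times_fqsym)

lemma fq_one_fqsym: "fq_one \<in> fqsym l"
  unfolding fq_one_def by (rule fqsym_G[of _ _ 0]) (simp add: cperms_iff)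

lemma inc_sum_component:
  assumes "set e \<subseteq> {..<l}"
  shows "inc_sum R e \<in> fq_component l (length e)"
  unfolding inc_sum_def fq_component_def
  using assms by (intro free.subspace_sum[OF subspace_keys]) (auto simp: inc_words_def cperms_iff)

lemma fq_component_subset: "fq_component l n \<subseteq> fqsym l"
  by (auto simp: fq_component_def fqsym_def)

lemma set_upt_1: "set [1..<n + 1] = {1..n}"
  by (simp only: set_upt Suc_eq_plus1[symmetric] atLeastLessThanSuc_atLeastAtMost)

lemma upt_perms: "[1..<n + 1] \<in> perms n"
  using set_upt_1[of n] by (simp add: perms_def permutations_of_set_def)

lemma chain_UNIV: "transp P \<Longrightarrow> chain P UNIV w \<longleftrightarrow> sorted_wrt P w"
  by (simp add: chain_def sorted_wrt_iff_nth_Suc_transp)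

text \<open>A strictly sorted list is determined by its set of letters. Hence with all positions
  linked the sum has a single term, as in \<open>S_mono_eq\<close>.\<close>

lemma inc_words_UNIV: "inc_words UNIV n = {[1..<n + 1]}"
proof -
  have "\<sigma> = [1..<n + 1]" if "\<sigma> \<in> perms n" "chain (<) UNIV \<sigma>" for \<sigma>
  proof (rule strict_sorted_equal)
    show "sorted_wrt (<) \<sigma>"
      using that(2) by (simp add: chain_UNIV)
    show "set \<sigma> = set [1..<n + 1]" using permsD(2)[OF that(1)] set_upt_1 by simp
  qed (rule sorted_wrt_upt)
  moreover have "chain (<) UNIV [1..<n + 1]" by (simp only: chain_UNIV transp_on_less sorted_wrt_upt)
  ultimately show ?thesis using upt_perms[of n] unfolding inc_words_def by blast
qed

section \<open>\<open>MR\<close> as the span of increasing sums with monochromatic blocks\<close>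

definition inc_sums :: "nat \<Rightarrow> (cperm \<Rightarrow>\<^sub>0 complex) set" where
  "inc_sums l = {inc_sum R e | R e. set e \<subseteq> {..<l} \<and> chain (=) R e}"

lemma inc_sums_times:
  assumes "x \<in> inc_sums l" "y \<in> inc_sums l"
  shows "fq_times x y \<in> inc_sums l"
proof -
  obtain R e S d where "x = inc_sum R e" "y = inc_sum S d" "set e \<subseteq> {..<l}" "set d \<subseteq> {..<l}"
    "chain (=) R e" "chain (=) S d"
    using assms by (auto simp: inc_sums_def)
  then show ?thesis unfolding inc_sums_def
    by (intro CollectI exI[of _ "join (length e) R S"] exI[of _ "e @ d"])
       (simp add: inc_sum_times chain_append)
qed

lemma inc_sums_fqsym: "inc_sums l \<subseteq> fqsym l"
proof
  fix x assume "x \<in> inc_sums l"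
  then obtain R e where "x = inc_sum R e" "set e \<subseteq> {..<l}" by (auto simp: inc_sums_def)
  then show "x \<in> fqsym l" using inc_sum_component[of e l R] fq_component_subset by auto
qed

lemma fq_subalgebra_span_inc_sums: "fq_subalgebra l (free.span (inc_sums l))"
  unfolding fq_subalgebra_def
proof (intro conjI ballI)
  show "free.span (inc_sums l) \<subseteq> fqsym l"
    by (intro free.span_minimal subspace_fqsym inc_sums_fqsym)
  have "inc_sum {} [] \<in> inc_sums l" unfolding inc_sums_def
    by (intro CollectI exI[of _ "{}"] exI[of _ "[]"]) simp
  then show "fq_one \<in> free.span (inc_sums l)" by (simp add: free.span_base)
  show "fq_times x y \<in> free.span (inc_sums l)"
    if "x \<in> free.span (inc_sums l)" "y \<in> free.span (inc_sums l)" for x y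
    using that unfolding fq_times_def
    by (rule bilin_ext_span[rotated 2])
       (auto intro: free.span_base inc_sums_times simp flip: fq_times_def)
qed simp

lemma inc_sum_replicate: "inc_sum UNIV (replicate n i) = G ([1..<n + 1], replicate n i)"
  by (simp only: inc_sum_def inc_words_UNIV length_replicate sum.insert) simp

text \<open>By induction on the length: if all neighbours are linked, \<open>chain (=) R e\<close>
  forces a single color and the sum is one of the generators; otherwise the sum factors at an
  unlinked position into two shorter ones.\<close>

lemma inc_sum_in_subalgebra:
  assumes T: "fq_subalgebra l T" "{S_mono l n i | n i. n \<ge> 1 \<and> i < l} \<subseteq> T"
    and "set e \<subseteq> {..<l}" "chain (=) R e"
  shows "inc_sum R e \<in> T"
  using assms(3,4)
proof (induction "length e" arbitrary: R e rule: less_induct)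
  case less
  consider "e = []" | "e \<noteq> []" "\<And>k. Suc k < length e \<Longrightarrow> k \<in> R"
    | k where "Suc k < length e" "k \<notin> R" by blast
  then show ?case
  proof cases
    case 1
    then show ?thesis using T(1) by (simp add: fq_subalgebra_def)
  next
    case 2
    have e: "e = replicate (length e) (e ! 0)"
    proof (rule nth_equalityI)
      fix k assume "k < length e"
      then have "e ! k = e ! 0"
        by (induction k) (use less.prems(2) 2(2) in \<open>auto simp: chain_def\<close>)
      then show "e ! k = replicate (length e) (e ! 0) ! k" using \<open>k < length e\<close> by simp
    qed simp
    have "inc_sum R e = inc_sum UNIV e" using 2 by (intro inc_sum_cong) simp
    also have "\<dots> = G ([1..<length e + 1], replicate (length e) (e ! 0))"
      by (metis e inc_sum_replicate)
    also have "\<dots> = S_mono l (length e) (e ! 0)"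
      using 2(1) less.prems(1) by (intro S_mono_eq[symmetric]) (auto simp: subset_iff)
    also have "\<dots> \<in> T"
    proof -
      have "e ! 0 < l" "length e \<ge> 1" using 2(1) less.prems(1) by (auto simp: subset_iff Suc_le_eq)
      then show ?thesis using T(2) by blast
    qed
    finally show ?thesis .
  next
    case (3 k)
    \<comment> \<open>The cut is placed between \<open>k\<close> and \<open>Suc k\<close>. The only
      position that \<open>join\<close> drops at the boundary is then \<open>k\<close> itself, which
      is not in \<open>R\<close>.\<close>
    let ?u = "take (Suc k) e" and ?v = "drop (Suc k) e" and ?B = "{j. Suc k + j \<in> R}"
    have R: "j \<in> R \<longleftrightarrow> j \<in> join (length ?u) R ?B" if "Suc j < length e" for j
    proof (cases "j \<le> k")
      case True
      then show ?thesis using 3 by (auto simp: join_def le_less)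
    next
      case False
      then obtain i where "j = Suc k + i" using le_Suc_ex[of "Suc k" j] by auto
      then show ?thesis using 3 by (auto simp: join_def image_iff)
    qed
    have "chain (=) (join (length ?u) R ?B) (?u @ ?v)"
      using less.prems(2) chain_cong[OF R, of e "(=)"] by simp
    then have c: "chain (=) R ?u" "chain (=) ?B ?v" by (auto simp only: chain_append)
    have "inc_sum R e = inc_sum (join (length ?u) R ?B) e" using R by (rule inc_sum_cong)
    also have "\<dots> = fq_times (inc_sum R ?u) (inc_sum ?B ?v)" by (simp add: inc_sum_times)
    also have "\<dots> \<in> T"
    proof -
      have "inc_sum R ?u \<in> T" using less.prems(1) 3 c(1) set_take_subset[of "Suc k" e]
        by (intro less.hyps) auto
      moreover have "inc_sum ?B ?v \<in> T" using less.prems(1) 3 c(2) set_drop_subset[of "Suc k" e]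
        by (intro less.hyps) auto
      ultimately show ?thesis using T(1) by (simp add: fq_subalgebra_def)
    qed
    finally show ?thesis .
  qed
qed

text \<open>The span is a subalgebra containing the generators, and by
  \<open>inc_sum_in_subalgebra\<close> every such subalgebra contains the span.\<close>

lemma MR_eq: "MR l = free.span (inc_sums l)"
proof
  have "S_mono l n i \<in> inc_sums l" if "i < l" for n i
    unfolding inc_sums_def S_mono_eq[OF that] inc_sum_replicate[symmetric]
    using that by (intro CollectI exI[of _ UNIV] exI[of _ "replicate n i"]) (auto simp: chain_def)
  then show "MR l \<subseteq> free.span (inc_sums l)" unfolding MR_def
    by (intro hull_minimal fq_subalgebra_span_inc_sums) (auto intro: free.span_base)
  show "free.span (inc_sums l) \<subseteq> MR l"
    unfolding MR_def hull_def
  proof (rule Inter_greatest)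
    fix T assume "T \<in> {T. fq_subalgebra l T \<and> {S_mono l n i | n i. n \<ge> 1 \<and> i < l} \<subseteq> T}"
    then show "free.span (inc_sums l) \<subseteq> T"
      using inc_sum_in_subalgebra[of l T]
      by (intro free.span_minimal) (auto simp: inc_sums_def fq_subalgebra_def)
  qed
qed

text \<open>The generators \<open>S_mono\<close> are complete functions and a Hopf subalgebra is a
  subalgebra, so each set in the intersection defining \<open>Sym\<close> contains
  \<open>MR\<close>.\<close>

lemma MR_subset_Sym: "MR l \<subseteq> Sym l"
  unfolding Sym_def hull_def[of "fq_hopf_subalgebra l"]
proof (rule Inter_greatest, elim CollectE conjE)
  fix T assume T: "fq_hopf_subalgebra l T" "{S_complete ns | ns. length ns = l} \<subseteq> T"
  have "{S_mono l n i | n i. n \<ge> 1 \<and> i < l} \<subseteq> {S_complete ns | ns. length ns = l}"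
    unfolding S_mono_def by (smt (verit) Collect_mono length_list_update length_replicate)
  moreover have "fq_subalgebra l T" using T(1) by (simp add: fq_hopf_subalgebra_def)
  ultimately show "MR l \<subseteq> T" unfolding MR_def using T(2) by (intro hull_minimal) (rule subset_trans)
qed

section \<open>Compositions\<close>

text \<open>These are the positions \<open>k\<close>, counted from 0, such that \<open>k\<close> and
  \<open>Suc k\<close> lie in the same block of the composition: the complement of the usual descent
  set of a composition.\<close>

fun joins :: "nat list \<Rightarrow> nat set" where
  "joins [] = {}"
| "joins (i # I) = join i UNIV (joins I)"

lemma blocks_increasing_iff:
  "length \<sigma> = sum_list I \<Longrightarrow>
   (\<forall>k<length I. sorted_wrt (<) (block I k \<sigma>)) \<longleftrightarrow> chain (<) (joins I) (\<sigma> :: nat list)"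
proof (induction I arbitrary: \<sigma>)
  case (Cons i I)
  have "(\<forall>k<length (i # I). sorted_wrt (<) (block (i # I) k \<sigma>))
      \<longleftrightarrow> sorted_wrt (<) (take i \<sigma>) \<and> (\<forall>k<length I. sorted_wrt (<) (block I k (drop i \<sigma>)))"
    by (simp add: All_less_Suc2 block_def add.commute)
  also have "\<dots> \<longleftrightarrow> chain (<) UNIV (take i \<sigma>) \<and> chain (<) (joins I) (drop i \<sigma>)"
    using Cons.IH[of "drop i \<sigma>"] Cons.prems by (simp add: chain_UNIV)
  also have "\<dots> \<longleftrightarrow> chain (<) (joins (i # I)) \<sigma>"
    using chain_append[of "(<)" "take i \<sigma>" UNIV "joins I" "drop i \<sigma>"] Cons.prems
    by (simp add: min_absorb2)
  finally show ?case .
qed simp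

abbreviation block_word :: "nat list \<Rightarrow> 'a list \<Rightarrow> 'a list" where
  "block_word I v \<equiv> concat (map2 replicate I v)"

lemma length_block_word: "length v = length I \<Longrightarrow> length (block_word I v) = sum_list I"
  by (induction v I rule: list_induct2) auto

lemma set_block_word: "set (block_word I v) \<subseteq> set v"
  by (auto dest: set_zip_rightD split: if_splits)

lemma chain_block_word: "length v = length I \<Longrightarrow> chain (=) (joins I) (block_word I v)"
proof (induction v I rule: list_induct2)
  case (Cons x v i I)
  then show ?case
    using chain_append[of "(=)" "replicate i x" UNIV "joins I" "block_word I v"]
    by (simp add: chain_def[of _ UNIV])
qed simp

text \<open>By induction on \<open>e\<close>: if 0 is unlinked, the first color opens a new block of
  size 1; if it is linked, it lengthens the first block of the rest, whose color it shares by
  \<open>chain (=) R\<close>.\<close>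

lemma exists_block_word:
  assumes "chain (=) R e"
  shows "\<exists>I v. I \<in> compositions (length e) \<and> length v = length I \<and> set v \<subseteq> set e \<and>
    block_word I v = e \<and> (\<forall>k. Suc k < length e \<longrightarrow> (k \<in> R \<longleftrightarrow> k \<in> joins I))"
  using assms
proof (induction e arbitrary: R)
  case Nil
  show ?case by (rule exI[of _ "[]"]) (auto simp: compositions_def)
next
  case (Cons c e)
  let ?R = "{k. Suc k \<in> R}"
  from Cons.prems have ch: "0 \<in> R \<Longrightarrow> e \<noteq> [] \<Longrightarrow> c = hd e" "chain (=) ?R e"
    by (simp_all add: chain_Cons)
  from Cons.IH[OF ch(2)] obtain I v where Iv:
    "I \<in> compositions (length e)" "length v = length I" "set v \<subseteq> set e" "block_word I v = e"
    and J: "\<And>k. Suc k < length e \<Longrightarrow> Suc k \<in> R \<longleftrightarrow> k \<in> joins I"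
    by auto
  show ?case
  proof (cases "0 \<in> R \<and> e \<noteq> []")
    case False
    have "k \<in> R \<longleftrightarrow> k \<in> joins (1 # I)" if "Suc k < length (c # e)" for k
      using J that False by (cases k) (auto simp: join_def)
    then show ?thesis using Iv
      by (intro exI[of _ "1 # I"] exI[of _ "c # v"]) (auto simp: compositions_def)
  next
    case True
    with Iv obtain i I' x v' where *: "I = i # I'" "v = x # v'"
      by (cases I; cases v) auto
    then have i: "i > 0" using Iv(1) by (auto simp: compositions_def)
    have x: "x = c" using ch(1) True Iv(4) i unfolding * by (cases i) auto
    have "k \<in> R \<longleftrightarrow> k \<in> joins (Suc i # I')" if "Suc k < length (c # e)" for k
    proof (cases k)
      case 0
      then show ?thesis using True i by (simp add: join_def)
    next
      case (Suc j)
      then show ?thesis using J[of j] that by (auto simp: * join_def image_iff)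
    qed
    moreover have "block_word (Suc i # I') (c # v') = c # e" using Iv(4) x by (simp add: *)
    moreover have "Suc i # I' \<in> compositions (length (c # e))"
      using Iv(1) by (simp add: * compositions_def)
    moreover have "length (c # v') = length (Suc i # I')" "set (c # v') \<subseteq> set (c # e)"
      using Iv(2,3) by (auto simp: *)
    ultimately show ?thesis by blast
  qed
qed

lemma mr_element_eq:
  assumes "I \<in> compositions n" "v \<in> color_words l (length I)"
  shows "mr_element l n I v = inc_sum (joins I) (block_word I v)"
proof -
  define w where "w = block_word I v"
  have len: "length w = n" and n: "sum_list I = n"
    using assms length_block_word[of v I] by (auto simp: w_def compositions_def color_words_def)
  have col: "set w \<subseteq> {..<l}"
    using assms(2) set_block_word[of I v] by (auto simp: w_def color_words_def)
  have "(\<forall>k < length I. sorted_wrt (<) (block I k \<sigma>)) \<longleftrightarrow> chain (<) (joins I) \<sigma>"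
    if "\<sigma> \<in> perms n" for \<sigma>
    using n permsD(3)[OF that] by (intro blocks_increasing_iff) simp
  then have "{(\<sigma>, u) \<in> carrier (wreath l n).
        u = w \<and> (\<forall>k < length I. sorted_wrt (<) (block I k \<sigma>))}
      = (\<lambda>\<sigma>. (\<sigma>, w)) ` inc_words (joins I) n"
    using len col by (auto simp: wreath_def cperms_iff inc_words_def)
  then show ?thesis unfolding mr_element_def inc_sum_def w_def[symmetric] len
    by (simp add: sum.reindex inj_on_def)
qed

lemma mr_elements_eq:
  "{mr_element l n I v | I v. I \<in> compositions n \<and> v \<in> color_words l (length I)}
   = {inc_sum R e | R e. e \<in> color_words l n \<and> chain (=) R e}" (is "?A = ?B")
proof
  show "?A \<subseteq> ?B"
  proof
    fix x assume "x \<in> ?A"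
    then obtain I v where x: "x = mr_element l n I v" and
      Iv: "I \<in> compositions n" "v \<in> color_words l (length I)" by auto
    have "block_word I v \<in> color_words l n"
      using Iv length_block_word[of v I] set_block_word[of I v]
      by (auto simp: compositions_def color_words_def)
    moreover have "chain (=) (joins I) (block_word I v)"
      using Iv by (intro chain_block_word) (simp add: color_words_def)
    ultimately show "x \<in> ?B" using mr_element_eq[OF Iv] x by blast
  qed
  show "?B \<subseteq> ?A"
  proof
    fix x assume "x \<in> ?B"
    then obtain R e where x: "x = inc_sum R e" and e: "e \<in> color_words l n" "chain (=) R e" by auto
    then have n: "length e = n" by (simp add: color_words_def)
    obtain I v where Iv: "I \<in> compositions n" "length v = length I" "set v \<subseteq> set e"
      "block_word I v = e" "\<And>k. Suc k < length e \<Longrightarrow> k \<in> R \<longleftrightarrow> k \<in> joins I"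
      using exists_block_word[OF e(2)] unfolding n by blast
    have v: "v \<in> color_words l (length I)" using Iv(2,3) e(1) by (auto simp: color_words_def)
    have "x = mr_element l n I v"
      unfolding mr_element_eq[OF Iv(1) v] x Iv(4) by (rule inc_sum_cong) (rule Iv(5))
    then show "x \<in> ?A" using Iv(1) v by blast
  qed
qed

section \<open>The graded components of \<open>MR\<close>\<close>

lemma mr_descent_algebra_eq:
  "mr_descent_algebra l n = free.span {inc_sum R e | R e. e \<in> color_words l n \<and> chain (=) R e}"
  unfolding mr_descent_algebra_def mr_elements_eq ..

lemma mr_descent_algebra_subset_MR: "mr_descent_algebra l n \<subseteq> MR l"
  unfolding mr_descent_algebra_eq MR_eq
  by (intro free.span_mono) (auto simp: inc_sums_def color_words_def)

lemma subspace_fq_component: "free.subspace (fq_component l n)"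
  unfolding fq_component_def by (rule subspace_keys)

lemma mr_descent_algebra_subset_component: "mr_descent_algebra l n \<subseteq> fq_component l n"
  unfolding mr_descent_algebra_eq
proof (intro free.span_minimal subspace_fq_component subsetI)
  fix x assume "x \<in> {inc_sum R e | R e. e \<in> color_words l n \<and> chain (=) R e}"
  then show "x \<in> fq_component l n"
    using inc_sum_component[of _ l] by (auto simp: color_words_def)
qed

lemma homogeneous_part_component:
  assumes "x \<in> fq_component l m"
  shows "homogeneous_part n x = (if m = n then x else 0)"
proof -
  have "length (fst h) = m" if "h \<in> Poly_Mapping.keys x" for h
    using assms that permsD(3) by (cases h) (auto simp: fq_component_def cperms_iff)
  then have *: "homogeneous_part n (scale c (basis h)) = (if m = n then scale c (basis h) else 0)"
    if "h \<in> Poly_Mapping.keys x" for c h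
    using that by (simp add: homogeneous_part_def lin_ext_scale)
  show ?thesis
    by (induction x rule: free_induct) (use * in \<open>simp_all add: homogeneous_part_def lin_ext_add\<close>)
qed

text \<open>Every spanning sum is homogeneous of degree \<open>length e\<close>, so the projection
  keeps it or kills it. Both the gradedness of \<open>MR\<close> and the description of its
  components follow.\<close>

lemma homogeneous_part_MR:
  assumes "x \<in> MR l"
  shows "homogeneous_part n x \<in> mr_descent_algebra l n"
proof -
  have "homogeneous_part n y \<in> mr_descent_algebra l n" if y: "y \<in> inc_sums l" for y
  proof -
    obtain R e where e: "y = inc_sum R e" "set e \<subseteq> {..<l}" "chain (=) R e"
      using y by (auto simp: inc_sums_def)
    have "inc_sum R e \<in> mr_descent_algebra l (length e)"
      unfolding mr_descent_algebra_eq using e by (intro free.span_base) (auto simp: color_words_def)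
    then show ?thesis
      using homogeneous_part_component[OF inc_sum_component[OF e(2)], of n R]
      by (auto simp: e(1) mr_descent_algebra_def free.span_zero)
  qed
  then show ?thesis
    unfolding homogeneous_part_def
    by (rule lin_ext_span[OF _ _ assms[unfolded MR_eq]]) (simp_all add: mr_descent_algebra_def)
qed

lemma is_graded_MR: "is_graded (MR l)"
  unfolding is_graded_def using homogeneous_part_MR mr_descent_algebra_subset_MR by blast

lemma MR_component: "MR l \<inter> fq_component l n = mr_descent_algebra l n"
proof
  show "MR l \<inter> fq_component l n \<subseteq> mr_descent_algebra l n"
  proof
    fix x assume "x \<in> MR l \<inter> fq_component l n"
    then show "x \<in> mr_descent_algebra l n"
      using homogeneous_part_MR[of x l n] homogeneous_part_component[of x l n n] by simp
  qed
qed (use mr_descent_algebra_subset_MR mr_descent_algebra_subset_component in blast)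

section \<open>Products in the group algebra\<close>

text \<open>This is the composite of the word \<open>w\<close> with \<open>\<tau>\<close>, i.e. the
  right action of permutations on words by positions; the subtraction turns letters starting at 1
  into list indices starting at 0.\<close>

definition pull :: "'a list \<Rightarrow> nat list \<Rightarrow> 'a list" where
  "pull w \<tau> = map (\<lambda>t. w ! (t - 1)) \<tau>"

lemma length_pull [simp]: "length (pull w \<tau>) = length \<tau>"
  by (simp add: pull_def)

lemma pull_nth: "i < length \<tau> \<Longrightarrow> pull w \<tau> ! i = w ! (\<tau> ! i - 1)"
  by (simp add: pull_def)

lemma perms_nth:
  assumes "\<tau> \<in> perms n" "i < n"
  shows "1 \<le> \<tau> ! i" "\<tau> ! i \<le> n" "\<tau> ! i - 1 < n"
proof -
  have "\<tau> ! i \<in> {1..n}" using assms permsD[OF assms(1)] nth_mem[of i \<tau>] by simp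
  then show "1 \<le> \<tau> ! i" "\<tau> ! i \<le> n" "\<tau> ! i - 1 < n" by auto
qed

lemma perms_nth_surj:
  assumes "\<tau> \<in> perms n" "k < n"
  obtains i where "i < n" "\<tau> ! i = Suc k"
proof -
  have "Suc k \<in> set \<tau>" using assms permsD(2)[OF assms(1)] by simp
  then show thesis using that permsD(3)[OF assms(1)] by (auto simp: in_set_conv_nth)
qed

lemma perms_nth_neq:
  assumes "\<tau> \<in> perms n" "i < n" "j < n" "i \<noteq> j"
  shows "\<tau> ! i \<noteq> \<tau> ! j"
  using permsD[OF assms(1)] assms by (simp add: nth_eq_iff_index_eq)

lemma mset_pull:
  assumes "\<tau> \<in> perms (length w)"
  shows "mset (pull w \<tau>) = mset w"
proof -
  have "mset \<tau> = mset [1..<length w + 1]"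
    using permsD[OF assms] set_upt_1 distinct_upt set_eq_iff_mset_eq_distinct by metis
  then have "mset (pull w \<tau>) = mset (pull w [1..<length w + 1])" by (simp only: pull_def mset_map)
  also have "pull w [1..<length w + 1] = w" by (rule nth_equalityI) (simp_all add: pull_nth del: upt_Suc)
  finally show ?thesis .
qed

lemma perms_mset: "\<sigma> \<in> perms n \<Longrightarrow> mset \<rho> = mset \<sigma> \<Longrightarrow> \<rho> \<in> perms n"
  unfolding perms_def permutations_of_set_def by (auto dest: mset_eq_setD mset_eq_imp_distinct_iff)

lemma pull_surj:
  assumes "\<tau> \<in> perms n" "length \<rho> = n"
  obtains \<sigma> where "length \<sigma> = n" "pull \<sigma> \<tau> = \<rho>"
proof
  \<comment> \<open>The definite description is the inverse of \<open>\<tau>\<close>, with arguments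
    and values counted from 0, so \<open>?s\<close> is \<open>\<rho>\<close> composed with that
    inverse.\<close>
  let ?s = "map (\<lambda>k. \<rho> ! (THE i. i < n \<and> \<tau> ! i = Suc k)) [0..<n]"
  show "length ?s = n" by simp
  show "pull ?s \<tau> = \<rho>"
  proof (rule nth_equalityI)
    fix i assume "i < length (pull ?s \<tau>)"
    then have i: "i < n" using permsD(3)[OF assms(1)] by simp
    have "(THE j. j < n \<and> \<tau> ! j = Suc (\<tau> ! i - 1)) = i"
      using i perms_nth[OF assms(1) i] perms_nth_neq[OF assms(1) _ i] by (intro the_equality) auto
    then show "pull ?s \<tau> ! i = \<rho> ! i"
      using i perms_nth(3)[OF assms(1) i] permsD(3)[OF assms(1)] by (simp add: pull_nth)
  qed (use assms permsD(3)[OF assms(1)] in simp)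
qed

lemma pull_inject:
  assumes "\<tau> \<in> perms n" "length v = n" "length w = n" "pull v \<tau> = pull w \<tau>"
  shows "v = w"
proof (rule nth_equalityI)
  fix k assume "k < length v"
  then obtain i where "i < n" "\<tau> ! i = Suc k" using perms_nth_surj[OF assms(1)] assms(2) by metis
  then show "v ! k = w ! k"
    using arg_cong[OF assms(4), of "\<lambda>u. u ! i"] permsD(3)[OF assms(1)] by (simp add: pull_nth)
qed (use assms in simp)

text \<open>The letters of \<open>\<tau>\<close> are totally ordered, so following its strict order
  in one direction already fixes all comparisons in \<open>z\<close>, including
  distinctness.\<close>

lemma std_eqI:
  assumes "\<tau> \<in> perms n" "length z = n"
    and "\<And>i j. i < n \<Longrightarrow> j < n \<Longrightarrow> \<tau> ! i < \<tau> ! j \<Longrightarrow> z ! i < z ! j"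
  shows "std z = \<tau>"
proof -
  have lin: "\<tau> ! i < \<tau> ! j \<or> \<tau> ! j < \<tau> ! i \<or> i = j" if "i < n" "j < n" for i j
    using perms_nth_neq[OF assms(1) that] by linarith
  have "std z = std \<tau>"
  proof (rule std_cong)
    show "distinct z" unfolding distinct_conv_nth
    proof (intro allI impI)
      fix i j assume "i < length z" "j < length z" "i \<noteq> j"
      then show "z ! i \<noteq> z ! j" using lin[of i j] assms(3)[of i j] assms(3)[of j i] assms(2) by auto
    qed
    fix i j assume "i < length \<tau>" "j < length \<tau>"
    then have ij: "i < n" "j < n" using permsD(3)[OF assms(1)] by simp_all
    show "z ! i \<le> z ! j \<longleftrightarrow> \<tau> ! i \<le> \<tau> ! j"
      using lin[OF ij] assms(3)[OF ij] assms(3)[OF ij(2,1)] by auto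
  qed (use assms permsD[OF assms(1)] in auto)
  then show ?thesis using std_id[OF assms(1)] by simp
qed

text \<open>The index of the block containing position \<open>k\<close>, if the elements of \<open>R\<close> are the positions not
  ending a block.\<close>

definition blk :: "nat set \<Rightarrow> nat \<Rightarrow> nat" where
  "blk R k = card {j. j < k \<and> j \<notin> R}"

lemma blk_Suc: "blk R (Suc k) = (if k \<in> R then blk R k else Suc (blk R k))"
proof -
  have "{j. j < Suc k \<and> j \<notin> R} = (if k \<in> R then {} else {k}) \<union> {j. j < k \<and> j \<notin> R}"
    by (auto simp: less_Suc_eq)
  then show ?thesis by (simp add: blk_def)
qed

lemma mono_blk: "a \<le> b \<Longrightarrow> blk R a \<le> blk R b"
  by (rule lift_Suc_mono_le[of "blk R"]) (auto simp: blk_Suc)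

text \<open>Since \<open>blk R\<close> is monotone, it is constant between two positions of equal
  value; all positions between them are linked and transitivity applies.\<close>

lemma chain_blk:
  assumes "chain P R w" "transp P" "a < b" "b < length w" "blk R a = blk R b"
  shows "P (w ! a) (w ! b)"
  using assms(3-5)
proof (induction b)
  case (Suc b)
  have "blk R a \<le> blk R b" "blk R b \<le> blk R (Suc b)" using Suc.prems mono_blk[of a b R] mono_blk[of b "Suc b" R] by auto
  then have b: "blk R a = blk R b" "b \<in> R" using Suc.prems by (auto simp: blk_Suc split: if_splits)
  then have 1: "P (w ! b) (w ! Suc b)" using assms(1) Suc.prems by (simp add: chain_def)
  show ?case
  proof (cases "a = b")
    case False
    then have "P (w ! a) (w ! b)" using Suc b by simp
    then show ?thesis using 1 assms(2) by (blast dest: transpD)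
  qed (use 1 in simp)
qed simp

section \<open>Closure of the descent algebra under the product of the group algebra\<close>

definition color_prod :: "nat \<Rightarrow> nat list \<Rightarrow> nat list \<Rightarrow> nat list \<Rightarrow> nat list" where
  "color_prod l c d \<tau> = map2 (\<lambda>a b. (a + b) mod l) (pull c \<tau>) d"

lemma wreath_mult:
  assumes "length \<tau> = n" "length d = n"
  shows "(\<sigma>, c) \<otimes>\<^bsub>wreath l n\<^esub> (\<tau>, d) = (pull \<sigma> \<tau>, color_prod l c d \<tau>)"
  using assms by (auto simp: wreath_def color_prod_def pull_nth intro!: nth_equalityI)

text \<open>For an equivalence relation the order of the two positions is irrelevant in
  \<open>chain_blk\<close>. With \<open>P\<close> equality, a color depends only on the block it is
  taken from.\<close>

lemma pull_blk_eq:
  assumes "chain P R w" "transp P" "reflp P" "\<tau> \<in> perms n" "\<tau>' \<in> perms n" "length w = n" "i < n" "j < n"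
    and "blk R (\<tau> ! i - 1) = blk R (\<tau>' ! j - 1)" "symp P"
  shows "P (w ! (\<tau> ! i - 1)) (w ! (\<tau>' ! j - 1))"
proof -
  let ?a = "\<tau> ! i - 1" and ?b = "\<tau>' ! j - 1"
  have "?a < n" "?b < n" using perms_nth(3) assms by auto
  then show ?thesis
    using chain_blk[OF assms(1,2), of ?a ?b] chain_blk[OF assms(1,2), of ?b ?a] assms
    by (cases ?a ?b rule: linorder_cases) (auto dest: sympD reflpD)
qed

text \<open>The word \<open>x\<close> records the block of \<open>\<sigma>\<close> visited at each
  position. As \<open>\<sigma>\<close> increases on its blocks, comparing the pairs of block and
  letter amounts to comparing the letters of \<open>\<tau>\<close>. The witness
  \<open>\<tau>0\<close> shows that \<open>x\<close> occurs: it supplies the multiset of letters of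
  \<open>x\<close> and the weak increase of \<open>x\<close> along \<open>S\<close> needed for
  surjectivity.\<close>

lemma bij_betw_pull:
  assumes \<tau>0: "\<tau>0 \<in> inc_words S n" and x: "x = pull (map (blk R) [0..<n]) \<tau>0"
  shows "bij_betw (\<lambda>(\<sigma>, \<tau>). pull \<sigma> \<tau>)
    {(\<sigma>, \<tau>). \<sigma> \<in> inc_words R n \<and> \<tau> \<in> inc_words S n \<and> pull (map (blk R) [0..<n]) \<tau> = x}
    (inc_words {k \<in> S. x ! k = x ! Suc k} n)"
proof -
  let ?\<beta> = "map (blk R) [0..<n]"
  let ?T = "{k \<in> S. x ! k = x ! Suc k}"
  \<comment> \<open>Since the letters of \<open>\<rho>\<close> are at most \<open>n\<close>, comparing these numbers is comparing the pairs
    \<open>(x ! i, \<rho> ! i)\<close> lexicographically.\<close>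
  define z where "z \<rho> = map2 (\<lambda>a r. a * Suc n + r) x \<rho>" for \<rho>
  have x_nth: "x ! i = blk R (\<tau> ! i - 1)"
    if "\<tau> \<in> perms n" "pull ?\<beta> \<tau> = x" "i < n" for \<tau> i
  proof -
    have "pull ?\<beta> \<tau> ! i = blk R (\<tau> ! i - 1)"
      using that(3) perms_nth(3)[OF that(1,3)] permsD(3)[OF that(1)] by (simp add: pull_nth)
    then show ?thesis using that(2) by simp
  qed
  have \<tau>0_perms: "\<tau>0 \<in> perms n" using \<tau>0 by (simp add: inc_words_def)
  then have len_x: "length x = n" using x permsD(3) by simp
  have len_z: "length (z \<rho>) = n" if "\<rho> \<in> perms n" for \<rho>
    using permsD(3)[OF that] len_x by (simp add: z_def)
  have z_less: "z \<rho> ! i < z \<rho> ! j \<longleftrightarrow> x ! i < x ! j \<or> x ! i = x ! j \<and> \<rho> ! i < \<rho> ! j"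
    if "\<rho> \<in> perms n" "i < n" "j < n" for \<rho> i j
  proof -
    have z: "z \<rho> ! k = x ! k * Suc n + \<rho> ! k" if "k < n" for k
      using that permsD(3)[OF \<open>\<rho> \<in> perms n\<close>] len_x by (simp add: z_def)
    have lex: "a * Suc n + r < b * Suc n + s" if "a < b" "r \<le> n" for a b r s
    proof -
      have "Suc a * Suc n \<le> b * Suc n" using that(1) by (intro mult_le_mono1) simp
      then show ?thesis using that(2) by simp
    qed
    show ?thesis
      using lex[of "x ! i" "x ! j" "\<rho> ! i" "\<rho> ! j"] lex[of "x ! j" "x ! i" "\<rho> ! j" "\<rho> ! i"]
        perms_nth(2)[OF that(1,2)] perms_nth(2)[OF that(1,3)]
      unfolding z[OF that(2)] z[OF that(3)]
      by (cases "x ! i" "x ! j" rule: linorder_cases) auto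
  qed
  have pull_std: "std (z (pull \<sigma> \<tau>)) = \<tau>" and pull_perms: "pull \<sigma> \<tau> \<in> perms n"
    and pull_less: "\<And>i j. i < n \<Longrightarrow> j < n \<Longrightarrow> \<tau> ! i < \<tau> ! j \<Longrightarrow> x ! i = x ! j \<Longrightarrow> pull \<sigma> \<tau> ! i < pull \<sigma> \<tau> ! j"
    if \<sigma>: "\<sigma> \<in> inc_words R n" and \<tau>: "\<tau> \<in> perms n" "pull ?\<beta> \<tau> = x" for \<sigma> \<tau>
  proof -
    have \<sigma>': "\<sigma> \<in> perms n" "chain (<) R \<sigma>" using \<sigma> by (auto simp: inc_words_def)
    note len = permsD(3)[OF \<tau>(1)] permsD(3)[OF \<sigma>'(1)]
    show p: "pull \<sigma> \<tau> \<in> perms n"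
      using mset_pull[of \<tau> \<sigma>] len \<tau>(1) by (intro perms_mset[OF \<sigma>'(1)]) simp
    show less: "pull \<sigma> \<tau> ! i < pull \<sigma> \<tau> ! j"
      if "i < n" "j < n" "\<tau> ! i < \<tau> ! j" "x ! i = x ! j" for i j
    proof -
      have "\<tau> ! i - 1 < \<tau> ! j - 1" using that(3) perms_nth(1)[OF \<tau>(1) that(1)] by linarith
      moreover have "\<tau> ! j - 1 < length \<sigma>" using perms_nth(3)[OF \<tau>(1) that(2)] len by simp
      moreover have "blk R (\<tau> ! i - 1) = blk R (\<tau> ! j - 1)"
        using that(4) x_nth[OF \<tau> that(1)] x_nth[OF \<tau> that(2)] by simp
      ultimately have "\<sigma> ! (\<tau> ! i - 1) < \<sigma> ! (\<tau> ! j - 1)" by (intro chain_blk[OF \<sigma>'(2)]) auto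
      then show ?thesis using that len by (simp add: pull_nth)
    qed
    \<comment> \<open>Along \<open>\<tau>\<close> the block index increases weakly, and ties are
      broken by the increase of \<open>\<sigma>\<close> inside a block.\<close>
    show "std (z (pull \<sigma> \<tau>)) = \<tau>"
    proof (rule std_eqI[OF \<tau>(1) len_z[OF p]])
      fix i j assume ij: "i < n" "j < n" "\<tau> ! i < \<tau> ! j"
      then have "x ! i \<le> x ! j" unfolding x_nth[OF \<tau> ij(1)] x_nth[OF \<tau> ij(2)]
        by (intro mono_blk diff_le_mono) simp
      then show "z (pull \<sigma> \<tau>) ! i < z (pull \<sigma> \<tau>) ! j"
        using less[OF ij] z_less[OF p ij(1,2)] by linarith
    qed
  qed
  show ?thesis
    unfolding bij_betw_def
  proof
    show "inj_on (\<lambda>(\<sigma>, \<tau>). pull \<sigma> \<tau>)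
      {(\<sigma>, \<tau>). \<sigma> \<in> inc_words R n \<and> \<tau> \<in> inc_words S n \<and> pull ?\<beta> \<tau> = x}"
    proof (rule inj_onI, clarify)
      fix \<sigma> \<tau> \<sigma>' \<tau>'
      assume *: "pull \<sigma> \<tau> = pull \<sigma>' \<tau>'" "\<sigma> \<in> inc_words R n" "\<sigma>' \<in> inc_words R n"
        "\<tau> \<in> inc_words S n" "\<tau>' \<in> inc_words S n" "x = pull ?\<beta> \<tau>" "pull ?\<beta> \<tau>' = pull ?\<beta> \<tau>"
      have \<tau>: "\<tau> \<in> perms n" "\<tau>' \<in> perms n" using *(4,5) by (simp_all add: inc_words_def)
      have \<beta>: "pull ?\<beta> \<tau> = x" "pull ?\<beta> \<tau>' = x" using *(6,7) by simp_all
      have \<sigma>: "\<sigma> \<in> perms n" "\<sigma>' \<in> perms n" using *(2,3) by (simp_all add: inc_words_def)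
      have eq: "\<tau> = \<tau>'"
        using pull_std[OF *(2) \<tau>(1) \<beta>(1)] pull_std[OF *(3) \<tau>(2) \<beta>(2)] unfolding *(1) by metis
      moreover have "\<sigma> = \<sigma>'"
        using pull_inject[OF \<tau>(1) permsD(3)[OF \<sigma>(1)] permsD(3)[OF \<sigma>(2)]] *(1) eq by metis
      ultimately show "\<sigma> = \<sigma>' \<and> \<tau> = \<tau>'" by simp
    qed
    show "(\<lambda>(\<sigma>, \<tau>). pull \<sigma> \<tau>) `
      {(\<sigma>, \<tau>). \<sigma> \<in> inc_words R n \<and> \<tau> \<in> inc_words S n \<and> pull ?\<beta> \<tau> = x} = inc_words ?T n"
    proof (intro equalityI subsetI)
      fix \<rho> assume "\<rho> \<in> (\<lambda>(\<sigma>, \<tau>). pull \<sigma> \<tau>) `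
        {(\<sigma>, \<tau>). \<sigma> \<in> inc_words R n \<and> \<tau> \<in> inc_words S n \<and> pull ?\<beta> \<tau> = x}"
      then obtain \<sigma> \<tau> where \<rho>: "\<rho> = pull \<sigma> \<tau>" and \<sigma>: "\<sigma> \<in> inc_words R n"
        and \<tau>: "\<tau> \<in> perms n" "chain (<) S \<tau>" "pull ?\<beta> \<tau> = x" by (auto simp: inc_words_def)
      show "\<rho> \<in> inc_words ?T n"
        using pull_perms[OF \<sigma> \<tau>(1,3)] pull_less[OF \<sigma> \<tau>(1,3)] \<tau>(2) permsD(3)[OF \<tau>(1)]
        by (auto simp: \<rho> inc_words_def chain_def)
    next
      fix \<rho> assume "\<rho> \<in> inc_words ?T n"
      then have \<rho>: "\<rho> \<in> perms n" "chain (<) ?T \<rho>" by (auto simp: inc_words_def)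
      note len_\<rho> = permsD(3)[OF \<rho>(1)]
      define \<tau> where "\<tau> = std (z \<rho>)"
      have "distinct (z \<rho>)" unfolding distinct_conv_nth
      proof (intro allI impI)
        fix i j assume "i < length (z \<rho>)" "j < length (z \<rho>)" "i \<noteq> j"
        then have ij: "i < n" "j < n" "i \<noteq> j" using len_z[OF \<rho>(1)] by simp_all
        have "z \<rho> ! i < z \<rho> ! j \<or> z \<rho> ! j < z \<rho> ! i"
          using perms_nth_neq[OF \<rho>(1) ij] z_less[OF \<rho>(1) ij(1,2)] z_less[OF \<rho>(1) ij(2,1)] by linarith
        then show "z \<rho> ! i \<noteq> z \<rho> ! j" by auto
      qed
      then have \<tau>: "\<tau> \<in> perms n" using std_perms[of "z \<rho>"] len_z[OF \<rho>(1)] by (simp add: \<tau>_def)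
      have \<tau>_less: "\<tau> ! i < \<tau> ! j \<longleftrightarrow> x ! i < x ! j \<or> x ! i = x ! j \<and> \<rho> ! i < \<rho> ! j"
        if "i < n" "j < n" for i j
        using that z_less[OF \<rho>(1) that] len_z[OF \<rho>(1)] by (simp add: \<tau>_def std_less_iff)
      note len_\<tau> = permsD(3)[OF \<tau>]
      \<comment> \<open>Transported back along \<open>\<tau>\<close>, the word \<open>x\<close>
        becomes sorted because \<open>\<tau>\<close> refines its order. It has the same letters as
        the sorted word \<open>?\<beta>\<close>, hence equals it.\<close>
      have pull_\<tau>: "pull ?\<beta> \<tau> = x"
      proof -
        obtain y where y: "length y = n" "pull y \<tau> = x" using pull_surj[OF \<tau> len_x] .
        have y_nth: "y ! k = x ! i" if "i < n" "\<tau> ! i = Suc k" for i k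
          using that len_\<tau> y(2) pull_nth[of i \<tau> y] by simp
        have "sorted y" unfolding sorted_iff_nth_mono_less
        proof (intro allI impI)
          fix a b assume "a < b" "b < length y"
          then have ab: "a < b" "a < n" "b < n" using y(1) by simp_all
          obtain i where i: "i < n" "\<tau> ! i = Suc a" using perms_nth_surj[OF \<tau> ab(2)] .
          obtain j where j: "j < n" "\<tau> ! j = Suc b" using perms_nth_surj[OF \<tau> ab(3)] .
          have "x ! i \<le> x ! j" using \<tau>_less[OF i(1) j(1)] i j ab(1) by auto
          then show "y ! a \<le> y ! b" using y_nth[OF i] y_nth[OF j] by simp
        qed
        moreover have "sorted ?\<beta>" by (auto simp: sorted_iff_nth_mono_less intro: mono_blk)
        moreover have "mset y = mset ?\<beta>"
        proof -
          have "mset y = mset x" using mset_pull[of \<tau> y] y \<tau> by simp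
          also have "\<dots> = mset ?\<beta>" using mset_pull[of \<tau>0 ?\<beta>] \<tau>0_perms unfolding x by simp
          finally show ?thesis .
        qed
        ultimately have "y = ?\<beta>"
          using properties_for_sort[of y ?\<beta>] sorted_sort_id[of ?\<beta>] by simp
        then show ?thesis using y(2) by simp
      qed
      obtain \<sigma> where \<sigma>: "length \<sigma> = n" "pull \<sigma> \<tau> = \<rho>" using pull_surj[OF \<tau> len_\<rho>] .
      have \<sigma>_nth: "\<sigma> ! k = \<rho> ! i" if "i < n" "\<tau> ! i = Suc k" for i k
        using that len_\<tau> \<sigma>(2) pull_nth[of i \<tau> \<sigma>] by simp
      have "\<sigma> \<in> perms n" using mset_pull[of \<tau> \<sigma>] \<sigma> \<tau> by (intro perms_mset[OF \<rho>(1)]) simp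
      \<comment> \<open>Linked positions of \<open>\<sigma>\<close> lie in one block, so
        \<open>\<tau>\<close> visits them at positions with equal \<open>x\<close>; there the order
        of \<open>\<tau>\<close> is that of \<open>\<rho>\<close>.\<close>
      moreover have "chain (<) R \<sigma>" unfolding chain_def
      proof (intro ballI impI)
        fix k assume k: "k \<in> R" "Suc k < length \<sigma>"
        then obtain i where i: "i < n" "\<tau> ! i = Suc k" using perms_nth_surj[OF \<tau>, of k] \<sigma>(1) by auto
        obtain j where j: "j < n" "\<tau> ! j = Suc (Suc k)"
          using perms_nth_surj[OF \<tau>, of "Suc k"] k(2) \<sigma>(1) by auto
        have "x ! i = x ! j"
          using x_nth[OF \<tau> pull_\<tau> i(1)] x_nth[OF \<tau> pull_\<tau> j(1)] i j k(1) by (simp add: blk_Suc)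
        then show "\<sigma> ! k < \<sigma> ! Suc k"
          using \<tau>_less[OF i(1) j(1)] \<sigma>_nth[OF i] \<sigma>_nth[OF j] i j by simp
      qed
      \<comment> \<open>At a position of \<open>S\<close> the word \<open>x\<close> increases
        weakly, because \<open>\<tau>0\<close> does so strictly. A strict step of \<open>x\<close>
        suffices for \<open>\<tau>\<close>, and an equality is resolved by the increase of
        \<open>\<rho>\<close>.\<close>
      moreover have "chain (<) S \<tau>" unfolding chain_def
      proof (intro ballI impI)
        fix k assume k: "k \<in> S" "Suc k < length \<tau>"
        then have kn: "k < n" "Suc k < n" using len_\<tau> by simp_all
        have "\<tau>0 ! k < \<tau>0 ! Suc k"
          using \<tau>0 k(1) kn permsD(3)[OF \<tau>0_perms] by (simp add: inc_words_def chain_def)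
        then have "x ! k \<le> x ! Suc k"
          unfolding x_nth[OF \<tau>0_perms x[symmetric] kn(1)] x_nth[OF \<tau>0_perms x[symmetric] kn(2)]
          by (intro mono_blk diff_le_mono) simp
        moreover have "\<rho> ! k < \<rho> ! Suc k" if "x ! k = x ! Suc k"
          using \<rho>(2) that k(1) kn(2) len_\<rho> by (simp add: chain_def)
        ultimately show "\<tau> ! k < \<tau> ! Suc k" using \<tau>_less[OF kn] by linarith
      qed
      ultimately have "(\<sigma>, \<tau>) \<in>
          {(\<sigma>, \<tau>). \<sigma> \<in> inc_words R n \<and> \<tau> \<in> inc_words S n \<and> pull ?\<beta> \<tau> = x}"
        using \<tau> pull_\<tau> by (simp add: inc_words_def)
      then show "\<rho> \<in> (\<lambda>(\<sigma>, \<tau>). pull \<sigma> \<tau>) `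
          {(\<sigma>, \<tau>). \<sigma> \<in> inc_words R n \<and> \<tau> \<in> inc_words S n \<and> pull ?\<beta> \<tau> = x}"
        using \<sigma>(2) by (intro image_eqI[of _ _ "(\<sigma>, \<tau>)"]) simp_all
    qed
  qed
qed

text \<open>The pairs of factors are grouped by the block word \<open>x\<close>. On one group the
  color word is constant and \<open>bij_betw_pull\<close> turns the products into a single
  increasing sum.\<close>

lemma ga_times_inc_sum:
  assumes l: "l \<ge> 1" and c: "c \<in> color_words l n" "chain (=) R c"
    and d: "d \<in> color_words l n" "chain (=) S d"
  shows "ga_times (wreath l n) (inc_sum R c) (inc_sum S d) \<in> mr_descent_algebra l n"
proof -
  let ?\<beta> = "map (blk R) [0..<n]"
  let ?P = "inc_words R n \<times> inc_words S n"
  let ?X = "\<lambda>(\<sigma> :: nat list, \<tau>). pull ?\<beta> \<tau>"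
  let ?g = "\<lambda>(\<sigma>, \<tau>). G (pull \<sigma> \<tau>, color_prod l c d \<tau>)"
  have len: "length c = n" "length d = n" using c d by (simp_all add: color_words_def)
  have "ga_times (wreath l n) (inc_sum R c) (inc_sum S d)
      = (\<Sum>\<sigma>\<in>inc_words R n. \<Sum>\<tau>\<in>inc_words S n. basis ((\<sigma>, c) \<otimes>\<^bsub>wreath l n\<^esub> (\<tau>, d)))"
    by (simp add: ga_times_def inc_sum_def len bilin_ext_sum_left bilin_ext_sum_right)
       (rule sum.swap)
  also have "\<dots> = (\<Sum>\<sigma>\<in>inc_words R n. \<Sum>\<tau>\<in>inc_words S n. ?g (\<sigma>, \<tau>))"
    using permsD(3)[of _ n] len by (intro sum.cong refl) (simp add: wreath_mult inc_words_def)
  also have "\<dots> = sum ?g ?P" by (simp add: sum.cartesian_product)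
  also have "\<dots> = (\<Sum>x\<in>?X ` ?P. sum ?g {p \<in> ?P. ?X p = x})"
    by (rule sum.image_gen) simp
  also have "\<dots> \<in> mr_descent_algebra l n"
    unfolding mr_descent_algebra_eq
  proof (rule free.subspace_sum[OF free.subspace_span])
    fix x assume "x \<in> ?X ` ?P"
    then obtain \<tau>0 where \<tau>0: "\<tau>0 \<in> inc_words S n" and x: "x = pull ?\<beta> \<tau>0" by auto
    let ?T = "{k \<in> S. x ! k = x ! Suc k}" and ?e = "color_prod l c d \<tau>0"
    have \<tau>0p: "\<tau>0 \<in> perms n" using \<tau>0 by (simp add: inc_words_def)
    have len_e: "length ?e = n" using len permsD(3)[OF \<tau>0p] by (simp add: color_prod_def)
    have x_nth: "x ! i = blk R (\<tau>0 ! i - 1)" if "i < n" for i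
      using that perms_nth(3)[OF \<tau>0p that] permsD(3)[OF \<tau>0p] by (simp add: x pull_nth)
    have c_eq: "c ! (\<tau> ! i - 1) = c ! (\<tau>' ! j - 1)"
      if "\<tau> \<in> perms n" "\<tau>' \<in> perms n" "i < n" "j < n" "blk R (\<tau> ! i - 1) = blk R (\<tau>' ! j - 1)"
      for \<tau> \<tau>' i j
      using pull_blk_eq[OF c(2) _ _ that(1,2) len(1) that(3,4,5)] by (simp add: transp_def reflp_def symp_def)
    \<comment> \<open>Blocks of \<open>c\<close> are monochromatic, so the permuted colors depend on
      \<open>\<tau>\<close> only through \<open>x\<close>.\<close>
    have e: "color_prod l c d \<tau> = ?e" if "\<tau> \<in> perms n" "pull ?\<beta> \<tau> = x" for \<tau>
    proof -
      have "pull c \<tau> ! i = pull c \<tau>0 ! i" if "i < n" for i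
      proof -
        have "pull ?\<beta> \<tau> ! i = blk R (\<tau> ! i - 1)"
          using that perms_nth(3)[OF \<open>\<tau> \<in> perms n\<close> that] permsD(3)[OF \<open>\<tau> \<in> perms n\<close>]
          by (simp add: pull_nth)
        then have "blk R (\<tau> ! i - 1) = blk R (\<tau>0 ! i - 1)"
          using \<open>pull ?\<beta> \<tau> = x\<close> x_nth[OF that] by simp
        then show ?thesis
          using c_eq[OF \<open>\<tau> \<in> perms n\<close> \<tau>0p that that] that permsD(3)[OF \<open>\<tau> \<in> perms n\<close>] permsD(3)[OF \<tau>0p]
          by (simp add: pull_nth)
      qed
      then have "pull c \<tau> = pull c \<tau>0"
        using permsD(3)[OF that(1)] permsD(3)[OF \<tau>0p] by (intro nth_equalityI) simp_all
      then show ?thesis by (simp add: color_prod_def)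
    qed
    have "sum ?g {p \<in> ?P. ?X p = x}
        = (\<Sum>(\<sigma>, \<tau>)\<in>{(\<sigma>, \<tau>). \<sigma> \<in> inc_words R n \<and> \<tau> \<in> inc_words S n \<and> pull ?\<beta> \<tau> = x}.
             G (pull \<sigma> \<tau>, ?e))"
      by (intro sum.cong) (auto simp: e inc_words_def)
    also have "\<dots> = inc_sum ?T ?e"
      unfolding inc_sum_def len_e
      using sum.reindex_bij_betw[OF bij_betw_pull[OF \<tau>0 x], of "\<lambda>\<rho>. G (\<rho>, ?e)"]
      by (simp add: case_prod_unfold)
    also have "\<dots> \<in> free.span {inc_sum R e | R e. e \<in> color_words l n \<and> chain (=) R e}"
    proof -
      \<comment> \<open>Linked positions take their colors of \<open>c\<close> from one block
        because \<open>x\<close> agrees there, and have equal colors in \<open>d\<close> because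
        they belong to \<open>S\<close>.\<close>
      have "chain (=) ?T ?e" unfolding chain_def
      proof (intro ballI impI)
        fix k assume k: "k \<in> ?T" "Suc k < length ?e"
        then have kn: "k < n" "Suc k < n" using len_e by simp_all
        have "c ! (\<tau>0 ! k - 1) = c ! (\<tau>0 ! Suc k - 1)"
          using k(1) x_nth[OF kn(1)] x_nth[OF kn(2)] by (intro c_eq[OF \<tau>0p \<tau>0p kn]) simp
        moreover have "d ! k = d ! Suc k" using k(1) kn len d(2) by (simp add: chain_def)
        ultimately show "?e ! k = ?e ! Suc k"
          using kn len permsD(3)[OF \<tau>0p] by (simp add: color_prod_def pull_nth)
      qed
      moreover have "?e \<in> color_words l n"
        using l len_e by (auto simp: color_words_def color_prod_def)
      ultimately show ?thesis by (intro free.span_base) blast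
    qed
    finally show "sum ?g {p \<in> ?P. ?X p = x}
      \<in> free.span {inc_sum R e | R e. e \<in> color_words l n \<and> chain (=) R e}" .
  qed
  finally show ?thesis .
qed

lemma ga_subalgebra_mr_descent_algebra:
  assumes "l \<ge> 1"
  shows "ga_subalgebra (wreath l n) (mr_descent_algebra l n)"
  unfolding ga_subalgebra_def
proof (intro conjI ballI)
  show "mr_descent_algebra l n \<subseteq> group_algebra (wreath l n)"
    using mr_descent_algebra_subset_component
    by (auto simp: group_algebra_def fq_component_def wreath_def)
  show "free.subspace (mr_descent_algebra l n)" by (simp add: mr_descent_algebra_def)
  have "basis \<one>\<^bsub>wreath l n\<^esub> = inc_sum UNIV (replicate n 0)"
    unfolding inc_sum_replicate by (simp add: wreath_def)
  moreover have "inc_sum UNIV (replicate n 0) \<in> mr_descent_algebra l n"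
    unfolding mr_descent_algebra_eq using assms
    by (intro free.span_base CollectI exI[of _ UNIV] exI[of _ "replicate n 0"])
       (auto simp: color_words_def chain_def)
  ultimately show "basis \<one>\<^bsub>wreath l n\<^esub> \<in> mr_descent_algebra l n" by simp
  show "ga_times (wreath l n) x y \<in> mr_descent_algebra l n"
    if xy: "x \<in> mr_descent_algebra l n" "y \<in> mr_descent_algebra l n" for x y
  proof -
    have sub: "free.subspace (mr_descent_algebra l n)" by (simp add: mr_descent_algebra_def)
    show ?thesis
      unfolding ga_times_def
      by (rule bilin_ext_span[OF _ sub xy[unfolded mr_descent_algebra_eq]])
         (auto simp flip: ga_times_def intro: ga_times_inc_sum[OF assms])
  qed
qed

section \<open>Restriction to intervals of letters\<close>

text \<open>Pairing letters with colors lets one filter handle both words. On a permutation word,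
  subtracting \<open>a\<close> does the work of standardization.\<close>

definition clip :: "nat \<Rightarrow> nat \<Rightarrow> (nat \<times> 'a) list \<Rightarrow> (nat \<times> 'a) list" where
  "clip a b z = map (\<lambda>(x, c). (x - a, c)) (filter (\<lambda>(x, c). a < x \<and> x \<le> b) z)"

text \<open>With half-open intervals, adjacent intervals share their endpoint, so splittings compose
  without index shifts.\<close>

definition restr :: "cperm \<Rightarrow> nat \<Rightarrow> nat \<Rightarrow> cperm" where
  "restr h a b = restrict_letters h (a + 1) b"

lemma clip_clip:
  assumes "a + d \<le> b"
  shows "clip c d (clip a b z) = clip (a + c) (a + d) z"
  using assms by (induction z) (auto simp: clip_def)

lemma map_fst_filter_zip:
  "length u = length w \<Longrightarrow> map fst (filter (\<lambda>(x, c). P x) (zip w u)) = filter P w"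
  by (induction u w rule: list_induct2) auto

text \<open>The letters kept from a permutation word fill the whole interval from
  \<open>Suc a\<close> to \<open>b\<close>, so standardizing them is a translation.\<close>

lemma std_filter_perms:
  assumes "\<sigma> \<in> perms n" "b \<le> n"
  shows "std (filter (\<lambda>x. a < x \<and> x \<le> b) \<sigma>) = map (\<lambda>x. x - a) (filter (\<lambda>x. a < x \<and> x \<le> b) \<sigma>)"
    and "map (\<lambda>x. x - a) (filter (\<lambda>x. a < x \<and> x \<le> b) \<sigma>) \<in> perms (b - a)"
proof -
  let ?w = "filter (\<lambda>x. a < x \<and> x \<le> b) \<sigma>"
  have dist: "distinct ?w" using permsD(1)[OF assms(1)] by simp
  have set_w: "set ?w = {Suc a..b}" using permsD(2)[OF assms(1)] assms(2) by auto
  have dist': "distinct (map (\<lambda>x. x - a) ?w)"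
    using dist by (auto simp: distinct_map inj_on_def)
  have "set (map (\<lambda>x. x - a) ?w) = (\<lambda>x. x - a) ` {Suc a..b}" using set_w by (simp only: set_map)
  also have "\<dots> = {1..b - a}"
  proof (intro equalityI subsetI)
    fix x assume "x \<in> {1..b - a}"
    then show "x \<in> (\<lambda>x. x - a) ` {Suc a..b}" by (intro image_eqI[of _ _ "x + a"]) auto
  qed auto
  finally show perm: "map (\<lambda>x. x - a) ?w \<in> perms (b - a)"
    using dist' by (simp add: perms_def permutations_of_set_def)
  have "std (map (\<lambda>x. x - a) ?w) = std ?w"
  proof (rule std_cong[OF dist' dist])
    fix i j assume "i < length ?w" "j < length ?w"
    moreover from this have "?w ! i \<in> {Suc a..b}" "?w ! j \<in> {Suc a..b}"
      using set_w nth_mem by blast+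
    ultimately show "map (\<lambda>x. x - a) ?w ! i \<le> map (\<lambda>x. x - a) ?w ! j \<longleftrightarrow> ?w ! i \<le> ?w ! j" by auto
  qed simp
  then show "std ?w = map (\<lambda>x. x - a) ?w" using std_id[OF perm] by simp
qed

lemma restr_eq:
  assumes "\<sigma> \<in> perms n" "length u = n" "b \<le> n"
  shows "restr (\<sigma>, u) a b = (map fst (clip a b (zip \<sigma> u)), map snd (clip a b (zip \<sigma> u)))"
proof -
  have len: "length u = length \<sigma>" using assms permsD(3) by simp
  have 1: "map fst (clip a b (zip \<sigma> u)) = map (\<lambda>x. x - a) (filter (\<lambda>x. a < x \<and> x \<le> b) \<sigma>)"
    unfolding map_fst_filter_zip[OF len, symmetric] clip_def by (simp add: case_prod_unfold)
  have 2: "map snd (clip a b (zip \<sigma> u)) = map snd (filter (\<lambda>(x, c). a < x \<and> x \<le> b) (zip \<sigma> u))"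
    unfolding clip_def by (simp add: case_prod_unfold)
  have 3: "std (map fst (filter (\<lambda>(x, c). a < x \<and> x \<le> b) (zip \<sigma> u)))
      = map (\<lambda>x. x - a) (filter (\<lambda>x. a < x \<and> x \<le> b) \<sigma>)"
    unfolding map_fst_filter_zip[OF len] by (rule std_filter_perms(1)[OF assms(1,3)])
  show ?thesis
    unfolding 1 2 3[symmetric] by (simp add: restr_def restrict_letters_def Let_def Suc_le_eq)
qed

lemma restr_cperms:
  assumes "h \<in> cperms l n" "b \<le> n"
  shows "restr h a b \<in> cperms l (b - a)"
proof -
  obtain \<sigma> u where h: "h = (\<sigma>, u)" "\<sigma> \<in> perms n" "length u = n" "set u \<subseteq> {..<l}"
    using assms(1) by (cases h) (auto simp: cperms_iff)
  have len: "length u = length \<sigma>" using h permsD(3) by simp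
  have 1: "map fst (clip a b (zip \<sigma> u)) = map (\<lambda>x. x - a) (filter (\<lambda>x. a < x \<and> x \<le> b) \<sigma>)"
    unfolding map_fst_filter_zip[OF len, symmetric] clip_def by (simp add: case_prod_unfold)
  have 2: "map fst (clip a b (zip \<sigma> u)) \<in> perms (b - a)"
    unfolding 1 by (rule std_filter_perms(2)[OF h(2) assms(2)])
  have "set (map snd (clip a b (zip \<sigma> u))) \<subseteq> set u"
    by (auto simp: clip_def dest: set_zip_rightD)
  then have "set (map snd (clip a b (zip \<sigma> u))) \<subseteq> {..<l}" using h(4) by simp
  moreover have "length (map snd (clip a b (zip \<sigma> u))) = b - a"
    using permsD(3)[OF 2] by simp
  ultimately show ?thesis
    using 2 unfolding h(1) restr_eq[OF h(2,3) assms(2)] cperms_iff by blast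
qed

text \<open>Both sides clip the same interval of letters. This is the combinatorial content of
  coassociativity, used for the antipode.\<close>

lemma restr_restr:
  assumes h: "h \<in> cperms l n" and "a \<le> b" "b \<le> n" "d \<le> b - a"
  shows "restr (restr h a b) c d = restr h (a + c) (a + d)"
proof -
  obtain \<sigma> u where *: "h = (\<sigma>, u)" "\<sigma> \<in> perms n" "length u = n"
    using h by (cases h) (auto simp: cperms_iff)
  let ?z = "clip a b (zip \<sigma> u)"
  have "(map fst ?z, map snd ?z) \<in> cperms l (b - a)"
    using restr_cperms[OF h assms(3), of a] restr_eq[OF *(2,3) assms(3)] *(1) by simp
  then have "restr (map fst ?z, map snd ?z) c d = (map fst (clip c d ?z), map snd (clip c d ?z))"
    using restr_eq[of "map fst ?z" "b - a" "map snd ?z" d c] assms(4)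
    by (simp add: cperms_iff zip_map_fst_snd)
  moreover have "clip c d ?z = clip (a + c) (a + d) (zip \<sigma> u)"
    using assms by (intro clip_clip) simp
  moreover have "a + d \<le> n" using assms by simp
  ultimately show ?thesis
    using restr_eq[OF *(2,3), of "a + d" "a + c"] restr_eq[OF *(2,3) assms(3), of a] *(1) by simp
qed

lemma cperms_length: "h \<in> cperms l n \<Longrightarrow> length (fst h) = n"
  using permsD(3) by (cases h) (simp add: cperms_iff)

lemma restr_self:
  assumes "h \<in> cperms l n" "a \<le> n"
  shows "restr h a a = ([], [])"
  using restr_cperms[OF assms, of a] by (cases "restr h a a") (simp add: cperms_iff)

lemma tensor_basis [simp]: "tensor (basis a) (basis b) = basis (a, b)"
  by (simp add: tensor_def)

lemma fq_coprod_G: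
  "length (fst h) = n \<Longrightarrow> fq_coprod (G h) = (\<Sum>i = 0..n. basis (restr h 0 i, restr h i n))"
  by (simp add: fq_coprod_def Let_def restr_def)

section \<open>The antipode\<close>

text \<open>The test for a permutation is only there to make the recursion terminate.\<close>

function antipode_basis :: "cperm \<Rightarrow> (cperm \<Rightarrow>\<^sub>0 complex)" where
  "antipode_basis h =
     (if fst h = [] then fq_one
      else if fst h \<in> perms (length (fst h)) \<and> length (snd h) = length (fst h)
      then - (\<Sum>i\<in>{..<length (fst h)}.
        fq_times (antipode_basis (restr h 0 i)) (G (restr h i (length (fst h)))))
      else 0)"
  by auto
termination
proof (relation "Wellfounded.measure (\<lambda>h. length (fst h))")
  fix h :: cperm and i
  assume *: "fst h \<in> perms (length (fst h)) \<and> length (snd h) = length (fst h)"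
    and i: "i \<in> {..<length (fst h)}"
  \<comment> \<open>Any strict bound on the colors serves here; it only places \<open>h\<close> in
    some \<open>cperms\<close>, so that the length of its restriction is known.\<close>
  have "h \<in> cperms (Suc (Max (set (snd h) \<union> {0}))) (length (fst h))"
    using * by (cases h) (auto simp: cperms_iff less_Suc_eq_le intro: Max_ge)
  then have "length (fst (restr h 0 i)) = i"
    using i restr_cperms[of h _ "length (fst h)" i 0] cperms_length[of "restr h 0 i" _ i] by auto
  then show "(restr h 0 i, h) \<in> Wellfounded.measure (\<lambda>h. length (fst h))" using i by simp
qed simp

declare antipode_basis.simps [simp del]

lemma antipode_basis_rec:
  assumes "h \<in> cperms l n" "n > 0"
  shows "antipode_basis h = - (\<Sum>i<n. fq_times (antipode_basis (restr h 0 i)) (G (restr h i n)))"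
proof -
  have "fst h \<in> perms n" "length (snd h) = n" "length (fst h) = n" "fst h \<noteq> []"
    using assms cperms_length[OF assms(1)] by (cases h; auto simp: cperms_iff)+
  then show ?thesis by (subst antipode_basis.simps) simp
qed

lemma antipode_basis_Nil: "fst h = [] \<Longrightarrow> antipode_basis h = fq_one"
  by (subst antipode_basis.simps) simp

lemma antipode_basis_fqsym: "h \<in> cperms l n \<Longrightarrow> antipode_basis h \<in> fqsym l"
proof (induction n arbitrary: h rule: less_induct)
  case (less n)
  show ?case
  proof (cases "n = 0")
    case True
    then show ?thesis using cperms_length[OF less.prems] fq_one_fqsym by (simp add: antipode_basis_Nil)
  next
    case False
    have "fq_times (antipode_basis (restr h 0 i)) (G (restr h i n)) \<in> fqsym l" if "i < n" for i
      using less.IH[OF that, of "restr h 0 i"] restr_cperms[OF less.prems, of i 0] that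
        fqsym_G[OF restr_cperms[OF less.prems, of n i]]
      by (intro fq_times_fqsym) simp_all
    then have "- (\<Sum>i<n. fq_times (antipode_basis (restr h 0 i)) (G (restr h i n))) \<in> fqsym l"
      by (intro free.subspace_neg[OF subspace_fqsym] free.subspace_sum[OF subspace_fqsym]) simp
    then show ?thesis using False antipode_basis_rec[OF less.prems] by simp
  qed
qed

text \<open>The recursion for the word restricted to an interval is rewritten by
  \<open>restr_restr\<close> in terms of subintervals of \<open>h\<close>. The summand with
  \<open>c = b\<close> has right factor one and is the left-hand side of the recursion.\<close>

lemma antipode_left:
  assumes h: "h \<in> cperms l n" and "a < b" "b \<le> n"
  shows "(\<Sum>c = a..b. fq_times (antipode_basis (restr h a c)) (G (restr h c b))) = 0"
proof -
  let ?f = "\<lambda>c. fq_times (antipode_basis (restr h a c)) (G (restr h c b))"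
  have hab: "restr h a b \<in> cperms l (b - a)" using restr_cperms[OF h assms(3)] .
  have "antipode_basis (restr h a b) = - (\<Sum>i<b - a. fq_times
      (antipode_basis (restr (restr h a b) 0 i)) (G (restr (restr h a b) i (b - a))))"
    using assms by (intro antipode_basis_rec[OF hab]) simp
  also have "\<dots> = - (\<Sum>i<b - a. ?f (a + i))"
    using assms by (intro arg_cong[of _ _ uminus] sum.cong refl) (simp add: restr_restr[OF h])
  also have "(\<Sum>i<b - a. ?f (a + i)) = sum ?f {a..<b}"
    using assms by (intro sum.reindex_bij_witness[of _ "\<lambda>c. c - a" "\<lambda>i. a + i"]) auto
  finally have 1: "antipode_basis (restr h a b) = - sum ?f {a..<b}" .
  have "?f b = antipode_basis (restr h a b)"
    using restr_self[OF h assms(3)] fq_times_one_right[OF antipode_basis_fqsym[OF hab]]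
    by (simp flip: fq_one_def)
  moreover have "sum ?f {a..b} = sum ?f {a..<b} + ?f b"
    using assms by (simp add: sum.last_plus add.commute)
  ultimately show ?thesis using 1 by simp
qed

lemma sum_triangle_swap:
  fixes a b :: nat
  shows "(\<Sum>c = a..b. \<Sum>d = c..b. f c d) = (\<Sum>d = a..b. \<Sum>c = a..d. f c d)"
  by (simp add: sum.Sigma, rule sum.reindex_bij_witness[of _ "\<lambda>(x, y). (y, x)" "\<lambda>(x, y). (y, x)"]) auto

text \<open>The elements \<open>M\<^bsub>ab\<^esub> = G (restr h a b)\<close> form a unitriangular matrix with left inverse
  \<open>L\<^bsub>ab\<^esub> = antipode_basis (restr h a b)\<close>; expanding \<open>L(ML) = (LM)L = L\<close> shows that \<open>L\<close> is also a
  right inverse.\<close>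

lemma antipode_right:
  assumes h: "h \<in> cperms l n" and "a < b" "b \<le> n"
  shows "(\<Sum>c = a..b. fq_times (G (restr h a c)) (antipode_basis (restr h c b))) = 0"
  using assms(2,3)
proof (induction "b - a" arbitrary: a rule: less_induct)
  case less
  let ?L = "\<lambda>a b. antipode_basis (restr h a b)" and ?M = "\<lambda>a b. G (restr h a b)"
  let ?P = "\<lambda>c. \<Sum>d = c..b. fq_times (?M c d) (?L d b)"
  have L1: "?L c c = fq_one" if "c \<le> n" for c
    using that by (simp add: antipode_basis_Nil restr_self[OF h])
  have M1: "?M c c = fq_one" if "c \<le> n" for c
    using that by (simp add: fq_one_def restr_self[OF h])
  have Lf: "?L c d \<in> fqsym l" if "d \<le> n" for c d
    by (rule antipode_basis_fqsym[OF restr_cperms[OF h that]])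
  have Mf: "?M c d \<in> fqsym l" if "d \<le> n" for c d
    by (rule fqsym_G[OF restr_cperms[OF h that]])
  have Pa: "?P a \<in> fqsym l"
    using less.prems by (intro free.subspace_sum[OF subspace_fqsym] fq_times_fqsym Lf Mf) auto
  \<comment> \<open>Reassociating and exchanging the sums puts the left identity inside: its sum
    vanishes unless \<open>d = a\<close>, where it is one.\<close>
  have "(\<Sum>c = a..b. fq_times (?L a c) (?P c))
      = (\<Sum>c = a..b. \<Sum>d = c..b. fq_times (fq_times (?L a c) (?M c d)) (?L d b))"
    by (simp add: fq_times_sum_right fq_times_assoc)
  also have "\<dots> = (\<Sum>d = a..b. fq_times (\<Sum>c = a..d. fq_times (?L a c) (?M c d)) (?L d b))"
    by (subst sum_triangle_swap) (simp add: fq_times_sum_left)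
  also have "\<dots> = (\<Sum>d = a..b. if d = a then ?L a b else 0)"
  proof (intro sum.cong refl)
    fix d assume d: "d \<in> {a..b}"
    show "fq_times (\<Sum>c = a..d. fq_times (?L a c) (?M c d)) (?L d b) = (if d = a then ?L a b else 0)"
    proof (cases "d = a")
      case True
      then show ?thesis
        using less.prems by (simp add: L1 M1 fq_times_one_left[OF fq_one_fqsym[of l]] fq_times_one_left[OF Lf])
    next
      case False
      then show ?thesis using antipode_left[OF h, of a d] d less.prems by simp
    qed
  qed
  also have "\<dots> = ?L a b" using less.prems by simp
  finally have 1: "(\<Sum>c = a..b. fq_times (?L a c) (?P c)) = ?L a b" .
  \<comment> \<open>By the induction hypothesis the right identity holds strictly between the
    endpoints, which leaves \<open>?P a\<close> from \<open>c = a\<close> and \<open>?L a b\<close>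
    from \<open>c = b\<close>. Comparison with the first evaluation gives
    \<open>?P a = 0\<close>.\<close>
  have "(\<Sum>c = a..b. fq_times (?L a c) (?P c)) = (\<Sum>c\<in>{a, b}. fq_times (?L a c) (?P c))"
  proof (rule sum.mono_neutral_right)
    show "\<forall>c\<in>{a..b} - {a, b}. fq_times (?L a c) (?P c) = 0"
    proof
      fix c assume "c \<in> {a..b} - {a, b}"
      then have "?P c = 0" using less.prems by (intro less.hyps) auto
      then show "fq_times (?L a c) (?P c) = 0" by simp
    qed
  qed (use less.prems in auto)
  also have "\<dots> = fq_times (?L a a) (?P a) + fq_times (?L a b) (?P b)"
    using less.prems by (subst sum.insert) auto
  also have "fq_times (?L a a) (?P a) = ?P a"
    using L1[of a] less.prems fq_times_one_left[OF Pa] by simp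
  also have "?P b = fq_one" using less.prems by (simp add: L1 M1 fq_times_one_left[OF fq_one_fqsym[of l]])
  also have "fq_times (?L a b) fq_one = ?L a b" using less.prems by (intro fq_times_one_right[OF Lf])
  finally show ?case using 1 by simp
qed

section \<open>The antipode as two-sided convolution inverse of the identity\<close>

definition antipode :: "(cperm \<Rightarrow>\<^sub>0 complex) \<Rightarrow> (cperm \<Rightarrow>\<^sub>0 complex)" where
  "antipode = lin_ext antipode_basis"

lemma antipode_G [simp]: "antipode (G h) = antipode_basis h"
  by (simp add: antipode_def)

lemma antipode_one [simp]: "antipode fq_one = fq_one"
  by (simp add: fq_one_def antipode_basis_Nil)

lemma convolution_add: "convolution P Q (x + y) = convolution P Q x + convolution P Q y"
  by (simp add: convolution_def fq_coprod_def lin_ext_add)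

lemma convolution_scale: "convolution P Q (scale c x) = scale c (convolution P Q x)"
  by (simp add: convolution_def fq_coprod_def lin_ext_scale)

lemma convolution_G:
  "length (fst h) = n \<Longrightarrow>
   convolution P Q (G h) = (\<Sum>i = 0..n. fq_times (P (G (restr h 0 i))) (Q (G (restr h i n))))"
  by (simp add: convolution_def fq_coprod_G lin_ext_sum)

lemma convolution_0 [simp]: "convolution P Q 0 = 0"
  by (simp add: convolution_def fq_coprod_def)

text \<open>By linearity it is enough to test basis elements, and the counit is 1 exactly on the
  empty colored permutation.\<close>

lemma convolution_eq_counit:
  assumes x: "x \<in> fqsym l"
    and G: "\<And>h n. h \<in> cperms l n \<Longrightarrow> convolution P Q (G h) = (if n = 0 then fq_one else 0)"
  shows "convolution P Q x = scale (fq_counit x) fq_one"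
proof -
  have *: "convolution P Q (G h) = scale (fq_counit (G h)) fq_one" if key: "h \<in> Poly_Mapping.keys x" for h
  proof -
    obtain n where h: "h \<in> cperms l n" using x key by (auto simp: fqsym_def)
    then have "n = 0 \<longleftrightarrow> h = ([], [])"
      using cperms_length[OF h] by (cases h) (auto simp: cperms_iff)
    then have "fq_counit (G h) = (if n = 0 then 1 else 0)"
      by (auto simp: fq_counit_def basis_def lookup_single when_def)
    then show ?thesis using G[OF h] by simp
  qed
  show ?thesis
  proof (induction x rule: free_induct)
    case (add x y)
    then show ?case by (simp add: convolution_add fq_counit_def lookup_add free.scale_left_distrib)
  next
    case (scale c h)
    then show ?case using *[OF scale] by (simp add: convolution_scale fq_counit_def)
  qed (simp add: fq_counit_def)
qed

lemma is_antipode_antipode: "is_antipode l antipode"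
  unfolding is_antipode_def
proof (intro conjI ballI)
  show "Vector_Spaces.linear scale scale antipode" unfolding antipode_def by (rule linear_lin_ext)
  show "antipode ` fqsym l \<subseteq> fqsym l"
  proof
    fix y assume "y \<in> antipode ` fqsym l"
    then obtain x where x: "x \<in> fqsym l" "y = lin_ext antipode_basis x" by (auto simp: antipode_def)
    show "y \<in> fqsym l" unfolding x(2)
      by (rule lin_ext_span[OF _ subspace_fqsym fqsym_span[OF x(1)]]) (auto intro: antipode_basis_fqsym)
  qed
  fix x assume x: "x \<in> fqsym l"
  show "convolution antipode id x = scale (fq_counit x) fq_one"
  proof (rule convolution_eq_counit[OF x])
    fix h n assume h: "h \<in> cperms l n"
    show "convolution antipode id (G h) = (if n = 0 then fq_one else 0)"
    proof (cases "n = 0")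
      case True
      then show ?thesis
        using h restr_self[OF h] fq_times_one_left[OF fq_one_fqsym[of l]]
        by (simp add: convolution_G[OF cperms_length[OF h]] flip: fq_one_def del: antipode_G)
    next
      case False
      then show ?thesis using antipode_left[OF h, of 0 n] by (simp add: convolution_G[OF cperms_length[OF h]])
    qed
  qed
  show "convolution id antipode x = scale (fq_counit x) fq_one"
  proof (rule convolution_eq_counit[OF x])
    fix h n assume h: "h \<in> cperms l n"
    show "convolution id antipode (G h) = (if n = 0 then fq_one else 0)"
    proof (cases "n = 0")
      case True
      then show ?thesis
        using h restr_self[OF h] fq_times_one_left[OF fq_one_fqsym[of l]]
        by (simp add: convolution_G[OF cperms_length[OF h]] flip: fq_one_def del: antipode_G)
    next
      case False
      then show ?thesis using antipode_right[OF h, of 0 n] by (simp add: convolution_G[OF cperms_length[OF h]])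
    qed
  qed
qed

section \<open>Splitting a word along a subset of its positions\<close>

fun sel :: "bool list \<Rightarrow> 'a list \<Rightarrow> 'a list" where
  "sel (x # b) (y # w) = (if x then y # sel b w else sel b w)"
| "sel _ _ = []"

text \<open>Positions are those of the selected word: two consecutive selected letters are linked
  only if they were adjacent in the original word and linked there by \<open>R\<close>.\<close>

fun sel_joins :: "nat set \<Rightarrow> bool list \<Rightarrow> nat set" where
  "sel_joins R [] = {}"
| "sel_joins R (x # b) =
     (if x then {k. k = 0 \<and> 0 \<in> R \<and> b \<noteq> [] \<and> hd b} \<union> Suc ` sel_joins {k. Suc k \<in> R} b
      else sel_joins {k. Suc k \<in> R} b)"

text \<open>This is the inverse of splitting a word into its marked and unmarked letters.\<close>

fun merge :: "bool list \<Rightarrow> 'a list \<Rightarrow> 'a list \<Rightarrow> 'a list" where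
  "merge [] u v = []"
| "merge (x # b) u v = (if x then hd u # merge b (tl u) v else hd v # merge b u (tl v))"

abbreviation trues :: "bool list \<Rightarrow> nat" where
  "trues b \<equiv> length (filter id b)"

abbreviation falses :: "bool list \<Rightarrow> nat" where
  "falses b \<equiv> length (filter Not b)"

lemma length_merge [simp]: "length (merge b u v) = length b"
  by (induction b arbitrary: u v) auto

lemma length_sel: "length b = length w \<Longrightarrow> length (sel b w) = trues b"
  by (induction b w rule: list_induct2) auto

lemma length_sel_Not: "length b = length w \<Longrightarrow> length (sel (map Not b) w) = falses b"
  by (induction b w rule: list_induct2) auto

lemma sel_merge:
  "length u = trues b \<Longrightarrow> length v = falses b \<Longrightarrow> sel b (merge b u v) = u"
  "length u = trues b \<Longrightarrow> length v = falses b \<Longrightarrow> sel (map Not b) (merge b u v) = v"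
proof (induction b arbitrary: u v)
  case (Cons x b)
  case 1 then show ?case using Cons.IH(1) by (cases u; cases v) (auto split: if_splits)
  case 2 then show ?case using Cons.IH(2) by (cases u; cases v) (auto split: if_splits)
qed auto

lemma merge_sel: "length b = length w \<Longrightarrow> merge b (sel b w) (sel (map Not b) w) = w"
  by (induction b w rule: list_induct2) auto

lemma set_merge:
  "length u = trues b \<Longrightarrow> length v = falses b \<Longrightarrow> set (merge b u v) = set u \<union> set v"
proof (induction b arbitrary: u v)
  case (Cons x b)
  then show ?case by (cases u; cases v) (auto split: if_splits)
qed simp

lemma map_merge:
  "length u = trues b \<Longrightarrow> length v = falses b \<Longrightarrow> \<forall>x\<in>set u. Q x \<Longrightarrow> \<forall>x\<in>set v. \<not> Q x \<Longrightarrow>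
   map Q (merge b u v) = b"
proof (induction b arbitrary: u v)
  case (Cons x b)
  then show ?case by (cases u; cases v) (auto split: if_splits)
qed simp

lemma chain_sel: "length b = length w \<Longrightarrow> chain P R w \<Longrightarrow> chain P (sel_joins R b) (sel b w)"
proof (induction b w arbitrary: R rule: list_induct2)
  case (Cons x b y w)
  let ?R = "{k. Suc k \<in> R}"
  have IH: "chain P (sel_joins ?R b) (sel b w)" using Cons by (simp add: chain_Cons)
  show ?case
  proof (cases x)
    case True
    have "P y (hd (sel b w))" if "0 \<in> R" "b \<noteq> []" "hd b"
      using that Cons.hyps Cons.prems by (cases b; cases w) (auto simp: chain_Cons)
    moreover have "{k. Suc k \<in> sel_joins R (x # b)} = sel_joins ?R b" using True by auto
    ultimately show ?thesis using True IH by (auto simp: chain_Cons)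
  qed (use IH in simp)
qed simp

text \<open>For a linked pair of neighbours with equal marks the relation is inherited from one
  selected word. A marked letter followed by an unmarked one is covered by the last hypothesis, and
  the opposite order is excluded by the condition on \<open>b\<close>.\<close>

lemma chain_unsel:
  assumes "length b = length w" "chain P (sel_joins R b) (sel b w)"
    "chain P (sel_joins R (map Not b)) (sel (map Not b) w)"
    "chain (\<lambda>p q. q \<longrightarrow> p) R b"
    "\<forall>x\<in>set (sel b w). \<forall>y\<in>set (sel (map Not b) w). P x y"
  shows "chain P R w"
  using assms
proof (induction b w arbitrary: R rule: list_induct2)
  case (Cons x b y w)
  let ?R = "{k. Suc k \<in> R}"
  have shift: "{k. Suc k \<in> {k. k = 0 \<and> 0 \<in> R \<and> c \<noteq> [] \<and> hd c} \<union> Suc ` sel_joins ?R c} = sel_joins ?R c"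
    for c :: "bool list" by auto
  have "chain P ?R w"
    using Cons.prems shift by (intro Cons.IH) (auto simp: chain_Cons split: if_splits)
  moreover have "P y (hd w)" if "0 \<in> R" "w \<noteq> []"
    using that Cons.hyps Cons.prems
    by (cases b; cases w; cases x; cases "hd b") (auto simp: chain_Cons)
  ultimately show ?case by (simp add: chain_Cons)
qed simp

lemma filter_zip_sel:
  "length u = length w \<Longrightarrow> map snd (filter (\<lambda>(x, c). Q x) (zip w u)) = sel (map Q w) u"
  by (induction u w rule: list_induct2) auto

lemma filter_sel: "filter Q w = sel (map Q w) w"
  by (induction w) auto

text \<open>Once the positions of the small letters are known, both restrictions of the color word
  depend on \<open>b\<close> and \<open>u\<close> alone. This is why the coproduct terms can be
  grouped by \<open>b\<close>.\<close>

lemma restr_sel: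
  assumes "\<sigma> \<in> perms n" "length u = n" "i \<le> n" and b: "map (\<lambda>x. x \<le> i) \<sigma> = b"
  shows "restr (\<sigma>, u) 0 i = (sel b \<sigma>, sel b u)"
    "restr (\<sigma>, u) i n = (map (\<lambda>x. x - i) (sel (map Not b) \<sigma>), sel (map Not b) u)"
proof -
  have len: "length u = length \<sigma>" using assms permsD(3) by simp
  have 1: "restr (\<sigma>, u) c d = (map (\<lambda>x. x - c) (sel (map (\<lambda>x. c < x \<and> x \<le> d) \<sigma>) \<sigma>),
      sel (map (\<lambda>x. c < x \<and> x \<le> d) \<sigma>) u)" if "d \<le> n" for c d
    unfolding restr_eq[OF assms(1,2) that] filter_sel[symmetric] filter_zip_sel[OF len, symmetric]
      map_fst_filter_zip[OF len, symmetric] clip_def by (simp add: case_prod_unfold)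
  have "map (\<lambda>x. 0 < x \<and> x \<le> i) \<sigma> = b" unfolding b[symmetric]
    using permsD(2)[OF assms(1)] by (intro map_cong refl) auto
  then show "restr (\<sigma>, u) 0 i = (sel b \<sigma>, sel b u)" using 1[OF assms(3), of 0] by simp
  have "map (\<lambda>x. i < x \<and> x \<le> n) \<sigma> = map Not b" unfolding b[symmetric] map_map
    using permsD(2)[OF assms(1)] by (intro map_cong refl) auto
  then show "restr (\<sigma>, u) i n = (map (\<lambda>x. x - i) (sel (map Not b) \<sigma>), sel (map Not b) u)"
    using 1[of n i] by simp
qed

lemma trues_falses: "trues b + falses b = length b"
  by (induction b) auto

lemma trues_le: "\<sigma> \<in> perms n \<Longrightarrow> i \<le> n \<Longrightarrow> trues (map (\<lambda>x. x \<le> i) \<sigma>) = i"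
proof -
  assume \<sigma>: "\<sigma> \<in> perms n" and i: "i \<le> n"
  have "trues (map (\<lambda>x. x \<le> i) \<sigma>) = length (filter (\<lambda>x. x \<le> i) \<sigma>)" by (simp add: filter_map comp_def id_def)
  also have "\<dots> = card (set (filter (\<lambda>x. x \<le> i) \<sigma>))"
    using permsD(1)[OF \<sigma>] by (intro distinct_card[symmetric]) simp
  also have "set (filter (\<lambda>x. x \<le> i) \<sigma>) = {1..i}" using permsD(2)[OF \<sigma>] i by auto
  also have "card {1..i} = i" by simp
  finally show ?thesis .
qed

lemma permsI': "set w = {1..n} \<Longrightarrow> length w = n \<Longrightarrow> w \<in> perms n"
  using card_distinct[of w] by (simp add: perms_def permutations_of_set_def)

text \<open>Here \<open>b\<close> marks the positions of the small letters; a large letter cannot precede a small one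
  at a position where the word has to increase.\<close>

definition split_pattern :: "nat set \<Rightarrow> nat \<Rightarrow> bool list \<Rightarrow> bool" where
  "split_pattern R n b \<longleftrightarrow> length b = n \<and> chain (\<lambda>p q. q \<longrightarrow> p) R b"

text \<open>For a fixed pattern, the small letters form a permutation word and so do the large ones
  after translation by \<open>trues b\<close>. The two can be chosen independently, and merging them
  recovers the word.\<close>

lemma bij_betw_split:
  assumes b: "split_pattern R n b"
  shows "bij_betw (\<lambda>\<sigma>. (sel b \<sigma>, map (\<lambda>x. x - trues b) (sel (map Not b) \<sigma>)))
    {\<sigma> \<in> inc_words R n. map (\<lambda>x. x \<le> trues b) \<sigma> = b}
    (inc_words (sel_joins R b) (trues b) \<times> inc_words (sel_joins R (map Not b)) (falses b))"
proof -
  let ?i = "trues b" and ?m = "falses b"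
  let ?inv = "\<lambda>(\<alpha>, \<gamma>). merge b \<alpha> (map (\<lambda>x. x + ?i) \<gamma>)"
  have n: "length b = n" "?i + ?m = n" and ch: "chain (\<lambda>p q. q \<longrightarrow> p) R b"
    using b trues_falses[of b] by (auto simp: split_pattern_def)
  then have i: "?i \<le> n" by simp
  show ?thesis
  proof (rule bij_betw_byWitness[where f' = ?inv])
    have big: "?i < x" if "map (\<lambda>x. x \<le> ?i) \<sigma> = b" "x \<in> set (sel (map Not b) \<sigma>)" for \<sigma> x
    proof -
      have "map Not b = map (\<lambda>x. \<not> x \<le> ?i) \<sigma>" by (subst that(1)[symmetric]) simp
      then have "x \<in> set (filter (\<lambda>x. \<not> x \<le> ?i) \<sigma>)" using that(2) unfolding filter_sel by simp
      then show ?thesis by simp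
    qed
    show "\<forall>\<sigma>\<in>{\<sigma> \<in> inc_words R n. map (\<lambda>x. x \<le> ?i) \<sigma> = b}.
        ?inv (sel b \<sigma>, map (\<lambda>x. x - ?i) (sel (map Not b) \<sigma>)) = \<sigma>"
    proof
      fix \<sigma> assume "\<sigma> \<in> {\<sigma> \<in> inc_words R n. map (\<lambda>x. x \<le> ?i) \<sigma> = b}"
      then have \<sigma>: "\<sigma> \<in> perms n" "map (\<lambda>x. x \<le> ?i) \<sigma> = b" by (auto simp: inc_words_def)
      have "map (\<lambda>x. x + ?i) (map (\<lambda>x. x - ?i) (sel (map Not b) \<sigma>)) = sel (map Not b) \<sigma>"
        unfolding map_map using big[OF \<sigma>(2)] by (intro map_idI) fastforce
      then show "?inv (sel b \<sigma>, map (\<lambda>x. x - ?i) (sel (map Not b) \<sigma>)) = \<sigma>"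
        using merge_sel[of b \<sigma>] n permsD(3)[OF \<sigma>(1)] by simp
    qed
    show "\<forall>p\<in>inc_words (sel_joins R b) ?i \<times> inc_words (sel_joins R (map Not b)) ?m.
        (sel b (?inv p), map (\<lambda>x. x - ?i) (sel (map Not b) (?inv p))) = p"
    proof
      fix p assume "p \<in> inc_words (sel_joins R b) ?i \<times> inc_words (sel_joins R (map Not b)) ?m"
      then obtain \<alpha> \<gamma> where p: "p = (\<alpha>, \<gamma>)" and "\<alpha> \<in> perms ?i" "\<gamma> \<in> perms ?m"
        by (auto simp: inc_words_def)
      then have "length \<alpha> = ?i" "length \<gamma> = ?m" using permsD(3) by blast+
      then show "(sel b (?inv p), map (\<lambda>x. x - ?i) (sel (map Not b) (?inv p))) = p"
        by (simp add: p sel_merge comp_def)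
    qed
    show "(\<lambda>\<sigma>. (sel b \<sigma>, map (\<lambda>x. x - ?i) (sel (map Not b) \<sigma>))) `
        {\<sigma> \<in> inc_words R n. map (\<lambda>x. x \<le> ?i) \<sigma> = b}
      \<subseteq> inc_words (sel_joins R b) ?i \<times> inc_words (sel_joins R (map Not b)) ?m"
    proof (rule image_subsetI)
      fix \<sigma> assume "\<sigma> \<in> {\<sigma> \<in> inc_words R n. map (\<lambda>x. x \<le> ?i) \<sigma> = b}"
      then have \<sigma>: "\<sigma> \<in> perms n" "chain (<) R \<sigma>" "map (\<lambda>x. x \<le> ?i) \<sigma> = b"
        by (auto simp: inc_words_def)
      have len: "length b = length \<sigma>" using n permsD(3)[OF \<sigma>(1)] by simp
      \<comment> \<open>A constant color word with \<open>l = 1\<close> makes the results on colored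
        permutations applicable to the bare word.\<close>
      have h: "(\<sigma>, replicate n 0) \<in> cperms 1 n" using \<sigma>(1) by (auto simp: cperms_iff)
      have "sel b \<sigma> \<in> perms ?i"
        using restr_cperms[OF h i, of 0] restr_sel(1)[OF \<sigma>(1) _ i \<sigma>(3), of "replicate n 0"]
        by (simp add: cperms_iff)
      moreover have "map (\<lambda>x. x - ?i) (sel (map Not b) \<sigma>) \<in> perms (n - ?i)"
        using restr_cperms[OF h order_refl, of ?i] restr_sel(2)[OF \<sigma>(1) _ i \<sigma>(3), of "replicate n 0"]
        by (simp add: cperms_iff)
      moreover have "n - ?i = ?m" using n(2) by simp
      moreover have "chain (<) (sel_joins R b) (sel b \<sigma>)"
        using len \<sigma>(2) by (rule chain_sel)
      moreover have "chain (<) (sel_joins R (map Not b)) (map (\<lambda>x. x - ?i) (sel (map Not b) \<sigma>))"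
      proof -
        have "chain (<) (sel_joins R (map Not b)) (sel (map Not b) \<sigma>)"
          using len \<sigma>(2) by (intro chain_sel) simp
        then show ?thesis unfolding chain_def
          using big[OF \<sigma>(3)] by (simp add: diff_less_mono less_imp_le)
      qed
      ultimately show "(sel b \<sigma>, map (\<lambda>x. x - ?i) (sel (map Not b) \<sigma>))
        \<in> inc_words (sel_joins R b) ?i \<times> inc_words (sel_joins R (map Not b)) ?m"
        by (simp add: inc_words_def)
    qed
    show "?inv ` (inc_words (sel_joins R b) ?i \<times> inc_words (sel_joins R (map Not b)) ?m)
      \<subseteq> {\<sigma> \<in> inc_words R n. map (\<lambda>x. x \<le> ?i) \<sigma> = b}"
    proof (rule image_subsetI)
      fix p assume "p \<in> inc_words (sel_joins R b) ?i \<times> inc_words (sel_joins R (map Not b)) ?m"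
      then obtain \<alpha> \<gamma> where p: "p = (\<alpha>, \<gamma>)" and \<alpha>: "\<alpha> \<in> perms ?i" "chain (<) (sel_joins R b) \<alpha>"
        and \<gamma>: "\<gamma> \<in> perms ?m" "chain (<) (sel_joins R (map Not b)) \<gamma>"
        by (auto simp: inc_words_def)
      let ?\<gamma> = "map (\<lambda>x. x + ?i) \<gamma>"
      let ?w = "merge b \<alpha> ?\<gamma>"
      have len: "length \<alpha> = ?i" "length ?\<gamma> = ?m" using permsD(3)[OF \<alpha>(1)] permsD(3)[OF \<gamma>(1)] by simp_all
      have sets: "\<forall>x\<in>set \<alpha>. 1 \<le> x \<and> x \<le> ?i" "\<forall>x\<in>set ?\<gamma>. ?i < x \<and> x \<le> n"
        using permsD(2)[OF \<alpha>(1)] permsD(2)[OF \<gamma>(1)] n(2) by auto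
      have "set ?\<gamma> = (\<lambda>x. x + ?i) ` {1..?m}" using permsD(2)[OF \<gamma>(1)] by simp
      also have "\<dots> = {1 + ?i..?m + ?i}" by (rule image_add_atLeastAtMost')
      finally have "set ?w = {1..?i} \<union> {1 + ?i..?m + ?i}"
        using permsD(2)[OF \<alpha>(1)] set_merge[OF len] by simp
      also have "\<dots> = {1..n}" using n(2) by auto
      finally have "?w \<in> perms n" using n(1) by (intro permsI') simp_all
      moreover have "chain (<) R ?w"
      proof (rule chain_unsel[OF _ _ _ ch])
        have "chain (<) (sel_joins R (map Not b)) ?\<gamma>" using \<gamma>(2) by (simp add: chain_def)
        then show "chain (<) (sel_joins R (map Not b)) (sel (map Not b) ?w)" unfolding sel_merge(2)[OF len] .
        show "chain (<) (sel_joins R b) (sel b ?w)" unfolding sel_merge(1)[OF len] by (rule \<alpha>(2))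
        show "\<forall>x\<in>set (sel b ?w). \<forall>y\<in>set (sel (map Not b) ?w). x < y"
          unfolding sel_merge[OF len] using sets by fastforce
      qed simp
      moreover have "map (\<lambda>x. x \<le> ?i) ?w = b" using sets by (intro map_merge[OF len]) auto
      ultimately show "?inv p \<in> {\<sigma> \<in> inc_words R n. map (\<lambda>x. x \<le> ?i) \<sigma> = b}"
        unfolding p by (simp add: inc_words_def)
    qed
  qed
qed

text \<open>The index \<open>i\<close> is recovered from the pattern as \<open>trues b\<close>. The
  function \<open>F\<close> and the set \<open>I\<close> stay general in order to serve both the
  coproduct, with all \<open>i\<close>, and the antipode recursion, with
  \<open>i < n\<close>.\<close>

lemma sum_split:
  fixes F :: "cperm \<Rightarrow> cperm \<Rightarrow> 'b :: comm_monoid_add"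
  assumes e: "length e = n" and I: "I \<subseteq> {0..n}"
  shows "(\<Sum>\<sigma>\<in>inc_words R n. \<Sum>i\<in>I. F (restr (\<sigma>, e) 0 i) (restr (\<sigma>, e) i n))
    = (\<Sum>b\<in>{b. split_pattern R n b \<and> trues b \<in> I}.
        \<Sum>\<alpha>\<in>inc_words (sel_joins R b) (trues b).
        \<Sum>\<gamma>\<in>inc_words (sel_joins R (map Not b)) (falses b).
          F (\<alpha>, sel b e) (\<gamma>, sel (map Not b) e))"
proof -
  let ?B = "{b. split_pattern R n b \<and> trues b \<in> I}"
  let ?g = "\<lambda>(\<sigma>, i). F (restr (\<sigma>, e) 0 i) (restr (\<sigma>, e) i n)"
  let ?f = "\<lambda>(\<sigma>, i). map (\<lambda>x. x \<le> i) \<sigma>"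
  have "finite I" using I by (rule finite_subset) simp
  have "?B \<subseteq> {b. set b \<subseteq> UNIV \<and> length b = n}" by (auto simp: split_pattern_def)
  then have finB: "finite ?B" by (rule finite_subset) (rule finite_lists_length_eq, simp)
  have fB: "?f p \<in> ?B" if "p \<in> inc_words R n \<times> I" for p
  proof -
    obtain \<sigma> i where p: "p = (\<sigma>, i)" "\<sigma> \<in> perms n" "chain (<) R \<sigma>" "i \<in> I"
      using \<open>p \<in> _\<close> by (auto simp: inc_words_def)
    then have "chain (\<lambda>p q. q \<longrightarrow> p) R (map (\<lambda>x. x \<le> i) \<sigma>)" by (auto simp: chain_def)
    moreover have "trues (map (\<lambda>x. x \<le> i) \<sigma>) = i" using p I by (intro trues_le) auto
    ultimately show ?thesis using p permsD(3)[OF p(2)] by (simp add: split_pattern_def)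
  qed
  have "(\<Sum>\<sigma>\<in>inc_words R n. \<Sum>i\<in>I. F (restr (\<sigma>, e) 0 i) (restr (\<sigma>, e) i n))
      = sum ?g (inc_words R n \<times> I)" by (simp add: sum.cartesian_product)
  also have "\<dots> = (\<Sum>b\<in>?B. sum ?g {p \<in> inc_words R n \<times> I. ?f p = b})"
    using fB \<open>finite I\<close> finB by (intro sum.group[symmetric]) auto
  also have "\<dots> = (\<Sum>b\<in>?B. \<Sum>\<alpha>\<in>inc_words (sel_joins R b) (trues b).
      \<Sum>\<gamma>\<in>inc_words (sel_joins R (map Not b)) (falses b). F (\<alpha>, sel b e) (\<gamma>, sel (map Not b) e))"
  proof (rule sum.cong[OF refl])
    fix b assume "b \<in> ?B"
    then have b: "split_pattern R n b" "trues b \<in> I" by auto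
    let ?A = "{\<sigma> \<in> inc_words R n. map (\<lambda>x. x \<le> trues b) \<sigma> = b}"
    have i: "trues b \<le> n" using b(2) I by auto
    have "{p \<in> inc_words R n \<times> I. ?f p = b} = (\<lambda>\<sigma>. (\<sigma>, trues b)) ` ?A"
    proof (intro equalityI subsetI)
      fix p assume "p \<in> {p \<in> inc_words R n \<times> I. ?f p = b}"
      then obtain \<sigma> j where p: "p = (\<sigma>, j)" "\<sigma> \<in> inc_words R n" "j \<in> I" "map (\<lambda>x. x \<le> j) \<sigma> = b" by auto
      then have "trues b = j" using trues_le[of \<sigma> n j] I by (auto simp: inc_words_def)
      then show "p \<in> (\<lambda>\<sigma>. (\<sigma>, trues b)) ` ?A" using p by auto
    qed (use b(2) in auto)
    then have "sum ?g {p \<in> inc_words R n \<times> I. ?f p = b}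
        = (\<Sum>\<sigma>\<in>?A. F (restr (\<sigma>, e) 0 (trues b)) (restr (\<sigma>, e) (trues b) n))"
      by (simp add: sum.reindex inj_on_def)
    also have "\<dots> = (\<Sum>\<sigma>\<in>?A. (\<lambda>(\<alpha>, \<gamma>). F (\<alpha>, sel b e) (\<gamma>, sel (map Not b) e))
        (sel b \<sigma>, map (\<lambda>x. x - trues b) (sel (map Not b) \<sigma>)))"
      using restr_sel[OF _ e i] by (intro sum.cong refl) (simp add: inc_words_def)
    also have "\<dots> = (\<Sum>(\<alpha>, \<gamma>)\<in>inc_words (sel_joins R b) (trues b) \<times>
        inc_words (sel_joins R (map Not b)) (falses b). F (\<alpha>, sel b e) (\<gamma>, sel (map Not b) e))"
      by (rule sum.reindex_bij_betw[OF bij_betw_split[OF b(1)]])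
    finally show "sum ?g {p \<in> inc_words R n \<times> I. ?f p = b}
        = (\<Sum>\<alpha>\<in>inc_words (sel_joins R b) (trues b).
          \<Sum>\<gamma>\<in>inc_words (sel_joins R (map Not b)) (falses b).
            F (\<alpha>, sel b e) (\<gamma>, sel (map Not b) e))"
      by (simp add: sum.cartesian_product)
  qed
  finally show ?thesis .
qed

section \<open>Coproduct and antipode on the increasing sums\<close>

lemma set_sel: "set (sel b w) \<subseteq> set w"
  by (induction b w rule: sel.induct) auto

lemma inc_sum_sel:
  assumes "split_pattern R (length e) b" "set e \<subseteq> {..<l}" "chain (=) R e"
  shows "inc_sum (sel_joins R b) (sel b e) \<in> inc_sums l"
    "inc_sum (sel_joins R (map Not b)) (sel (map Not b) e) \<in> inc_sums l"
  using assms set_sel[of b e] set_sel[of "map Not b" e]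
    chain_sel[of b e "(=)" R] chain_sel[of "map Not b" e "(=)" R]
  by (fastforce simp: inc_sums_def split_pattern_def)+

text \<open>By \<open>sum_split\<close>, the two tensor factors range independently once the pattern
  is fixed, so each pattern contributes one pure tensor of increasing sums.\<close>

lemma fq_coprod_inc_sum:
  "fq_coprod (inc_sum R e) = (\<Sum>b\<in>{b. split_pattern R (length e) b \<and> trues b \<in> {0..length e}}.
     tensor (inc_sum (sel_joins R b) (sel b e)) (inc_sum (sel_joins R (map Not b)) (sel (map Not b) e)))"
proof -
  have "fq_coprod (inc_sum R e) = (\<Sum>\<sigma>\<in>inc_words R (length e). fq_coprod (G (\<sigma>, e)))"
    by (simp add: inc_sum_def fq_coprod_def lin_ext_sum)
  also have "\<dots> = (\<Sum>\<sigma>\<in>inc_words R (length e). \<Sum>i\<in>{0..length e}.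
      tensor (G (restr (\<sigma>, e) 0 i)) (G (restr (\<sigma>, e) i (length e))))"
  proof (intro sum.cong refl)
    fix \<sigma> assume "\<sigma> \<in> inc_words R (length e)"
    then have "length (fst (\<sigma>, e)) = length e" using permsD(3) by (simp add: inc_words_def)
    then show "fq_coprod (G (\<sigma>, e)) = (\<Sum>i\<in>{0..length e}.
        tensor (G (restr (\<sigma>, e) 0 i)) (G (restr (\<sigma>, e) i (length e))))"
      by (subst fq_coprod_G) simp_all
  qed
  also have "\<dots> = (\<Sum>b\<in>{b. split_pattern R (length e) b \<and> trues b \<in> {0..length e}}.
      \<Sum>\<alpha>\<in>inc_words (sel_joins R b) (trues b).
      \<Sum>\<gamma>\<in>inc_words (sel_joins R (map Not b)) (falses b).
        tensor (G (\<alpha>, sel b e)) (G (\<gamma>, sel (map Not b) e)))"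
    by (rule sum_split[of e "length e" "{0..length e}" "\<lambda>h k. tensor (G h) (G k)"]) simp_all
  also have "\<dots> = (\<Sum>b\<in>{b. split_pattern R (length e) b \<and> trues b \<in> {0..length e}}.
      tensor (inc_sum (sel_joins R b) (sel b e)) (inc_sum (sel_joins R (map Not b)) (sel (map Not b) e)))"
    by (intro sum.cong refl)
       (simp add: inc_sum_def length_sel length_sel_Not split_pattern_def tensor_def
         bilin_ext_sum_left bilin_ext_sum_right, rule sum.swap)
  finally show ?thesis .
qed

lemma fq_coprod_MR: "fq_coprod ` MR l \<subseteq> tensor_space (MR l) (MR l)"
proof
  fix y assume "y \<in> fq_coprod ` MR l"
  then obtain x where x: "x \<in> free.span (inc_sums l)" and y: "y = fq_coprod x"
    unfolding MR_eq by auto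
  have "fq_coprod z \<in> tensor_space (MR l) (MR l)" if z: "z \<in> inc_sums l" for z
  proof -
    obtain R e where e: "z = inc_sum R e" "set e \<subseteq> {..<l}" "chain (=) R e"
      using z by (auto simp: inc_sums_def)
    show ?thesis unfolding e(1) fq_coprod_inc_sum tensor_space_def
    proof (rule free.subspace_sum[OF free.subspace_span])
      fix b assume "b \<in> {b. split_pattern R (length e) b \<and> trues b \<in> {0..length e}}"
      then have b: "split_pattern R (length e) b" by simp
      show "tensor (inc_sum (sel_joins R b) (sel b e)) (inc_sum (sel_joins R (map Not b)) (sel (map Not b) e))
        \<in> free.span {tensor a b | a b. a \<in> MR l \<and> b \<in> MR l}"
        using inc_sum_sel[OF b e(2,3)] unfolding MR_eq
        by (intro free.span_base) (blast intro: free.span_base)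
    qed
  qed
  then show "y \<in> tensor_space (MR l) (MR l)"
    unfolding y fq_coprod_def
    by (intro lin_ext_span[OF _ _ x]) (simp_all add: tensor_space_def)
qed

lemma fq_subalgebra_MR: "fq_subalgebra l (MR l)"
  unfolding MR_eq by (rule fq_subalgebra_span_inc_sums)

text \<open>Summed over the words, the recursion becomes by \<open>sum_split\<close> a sum over
  patterns. The range \<open>i < length e\<close> excludes the pattern marking every position, so
  each remaining antipode is applied to a shorter sum and the induction hypothesis applies.\<close>

lemma antipode_inc_sum:
  assumes "set e \<subseteq> {..<l}" "chain (=) R e"
  shows "antipode (inc_sum R e) \<in> MR l"
  using assms
proof (induction "length e" arbitrary: R e rule: less_induct)
  case less
  note alg = fq_subalgebra_MR[of l, unfolded fq_subalgebra_def]
  show ?case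
  proof (cases "e = []")
    case True
    then show ?thesis using alg by simp
  next
    case False
    let ?n = "length e"
    let ?B = "{b. split_pattern R ?n b \<and> trues b \<in> {..<?n}}"
    have "antipode (inc_sum R e) = (\<Sum>\<sigma>\<in>inc_words R ?n. antipode_basis (\<sigma>, e))"
      by (simp add: antipode_def inc_sum_def lin_ext_sum)
    also have "\<dots> = (\<Sum>\<sigma>\<in>inc_words R ?n. - (\<Sum>i\<in>{..<?n}.
        fq_times (antipode_basis (restr (\<sigma>, e) 0 i)) (G (restr (\<sigma>, e) i ?n))))"
      using False less.prems by (intro sum.cong refl antipode_basis_rec[of _ l]) (auto simp: inc_words_def cperms_iff)
    also have "\<dots> = - (\<Sum>\<sigma>\<in>inc_words R ?n. \<Sum>i\<in>{..<?n}.
        fq_times (antipode_basis (restr (\<sigma>, e) 0 i)) (G (restr (\<sigma>, e) i ?n)))"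
      by (rule sum_negf)
    also have "(\<Sum>\<sigma>\<in>inc_words R ?n. \<Sum>i\<in>{..<?n}.
        fq_times (antipode_basis (restr (\<sigma>, e) 0 i)) (G (restr (\<sigma>, e) i ?n)))
      = (\<Sum>b\<in>?B. \<Sum>\<alpha>\<in>inc_words (sel_joins R b) (trues b).
        \<Sum>\<gamma>\<in>inc_words (sel_joins R (map Not b)) (falses b).
          fq_times (antipode_basis (\<alpha>, sel b e)) (G (\<gamma>, sel (map Not b) e)))"
      by (rule sum_split[of e ?n "{..<?n}" "\<lambda>h k. fq_times (antipode_basis h) (G k)"]) auto
    also have "\<dots> = (\<Sum>b\<in>?B. fq_times (antipode (inc_sum (sel_joins R b) (sel b e)))
        (inc_sum (sel_joins R (map Not b)) (sel (map Not b) e)))"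
      by (intro sum.cong refl)
         (simp add: inc_sum_def length_sel length_sel_Not split_pattern_def antipode_def lin_ext_sum
           fq_times_sum_left fq_times_sum_right, rule sum.swap)
    finally have eq: "antipode (inc_sum R e) = - (\<Sum>b\<in>?B.
        fq_times (antipode (inc_sum (sel_joins R b) (sel b e)))
          (inc_sum (sel_joins R (map Not b)) (sel (map Not b) e)))" .
    have "fq_times (antipode (inc_sum (sel_joins R b) (sel b e)))
        (inc_sum (sel_joins R (map Not b)) (sel (map Not b) e)) \<in> MR l" if "b \<in> ?B" for b
    proof -
      have b: "split_pattern R ?n b" "trues b < ?n" using that by auto
      then have len: "length b = length e" by (simp add: split_pattern_def)
      have "antipode (inc_sum (sel_joins R b) (sel b e)) \<in> MR l"
        using b(2) len less.prems set_sel[of b e]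
        by (intro less.hyps) (auto simp: length_sel intro: chain_sel)
      moreover have "inc_sum (sel_joins R (map Not b)) (sel (map Not b) e) \<in> MR l"
        using inc_sum_sel(2)[OF b(1) less.prems] unfolding MR_eq by (rule free.span_base)
      ultimately show ?thesis using alg by blast
    qed
    then show ?thesis unfolding eq using alg
      by (intro free.subspace_neg free.subspace_sum) auto
  qed
qed

lemma fq_hopf_subalgebra_MR: "fq_hopf_subalgebra l (MR l)"
  unfolding fq_hopf_subalgebra_def
proof (intro conjI exI)
  show "antipode ` MR l \<subseteq> MR l"
  proof
    fix y assume "y \<in> antipode ` MR l"
    then obtain x where x: "x \<in> free.span (inc_sums l)" and y: "y = antipode x"
      unfolding MR_eq by auto
    have "antipode z \<in> MR l" if "z \<in> inc_sums l" for z
      using that antipode_inc_sum by (auto simp: inc_sums_def)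
    then show "y \<in> MR l"
      unfolding y antipode_def by (intro lin_ext_span[OF _ _ x]) (simp_all add: MR_eq)
  qed
qed (rule fq_subalgebra_MR fq_coprod_MR is_antipode_antipode)+

theorem proposition5p1:
  fixes l :: nat
  assumes "l \<ge> 1"
  shows "MR l \<subseteq> Sym l \<and> fq_hopf_subalgebra l (MR l) \<and> is_graded (MR l) \<and>
    (\<forall>n. ga_subalgebra (wreath l n) (mr_descent_algebra l n) \<and>
         bij_betw identification (MR l \<inter> fq_component l n) (mr_descent_algebra l n))"
proof (intro conjI allI)
  fix n
  \<comment> \<open>Both spaces use the same basis set, so the identification is the identity map
    and the bijection reduces to the equality \<open>MR_component\<close>.\<close>
  have "identification x = x" for x by (simp add: identification_def)
  then show "bij_betw identification (MR l \<inter> fq_component l n) (mr_descent_algebra l n)"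
    by (simp add: MR_component bij_betw_def inj_on_def)
qed (rule MR_subset_Sym fq_hopf_subalgebra_MR is_graded_MR
    ga_subalgebra_mr_descent_algebra[OF assms])+

end
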